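(* (i) The unit interval $[0,1]$ with Dirichlet boundary conditions, and the unit interval $[0,1]$ with Neumann boundary conditions, exhibit strong spooky action at a distance. (ii) The circle $\mathbb{S}^1$ with its canonical basis of eigenfunctions $\sin(kx), \cos(kx)$, $k\ge 1$, exhibits strong spooky action at a distance. (iii) A random basis of eigenfunctions $\sin(k(x-x_k)), \cos(k(x-x_k))$, $k \geq 1$, on the circle $\mathbb{S}^1$, where $x_1,x_2,\dots$ are independent and uniformly distributed on $[0,2\pi]$, almost surely does not exhibit spooky action at a distance.
   Context: For a sequence $(\phi_k)_{k\ge 1}$ of real-valued Laplacian eigenfunctions on $M$, listed in order of increasing eigenvalue (with multiplicity), and $n\in\mathbb{N}$, define $$A^{(n)}(x,y)=\sum_{k=1}^n \operatorname{sign}(\phi_k(x))\,\phi_k(y),\qquad x,y\in M,$$ where $\operatorname{sign}(z)=1$ if $z>0$, $0$ if $z=0$, and $-1$ if $z<0$. (The paper denotes $A^{(n)}$ by $\amalg^{(n)}$.) Definitions. The basis $(\phi_k)_{k\ge1}$ does not exhibit spooky action at a distance if there is a constant $c$ such that for all $x\neq y$ in $M$ there is a constant $C_{x,y}$ with $|A^{(n)}(x,y)|\le C_{x,y}(\log n)^c\sqrt n$ for all $n\ge 2$. The basis exhibits strong spooky action at a distance if there exist $x\ne y$ in $M$ with $\limsup_{n\to\infty}\frac1n|A^{(n)}(x,y)|>0$. On $[0,1]$ the $L^2$-normalized eigenfunctions are unique up to sign: $\sqrt2\sin(k\pi x)$, $k\ge1$ (Dirichlet), and $1,\ \sqrt2\cos(k\pi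 x)$, $k\ge1$ (Neumann); $A^{(n)}$ does not depend on the signs chosen. The circle is $\mathbb{S}^1\cong[0,2\pi]$ with endpoints identified. Its eigenfunctions are listed as $\sin(x),\cos(x),\sin(2x),\cos(2x),\dots$ for the canonical basis, and as $\sin(x-x_1),\cos(x-x_1),\sin(2(x-x_2)),\cos(2(x-x_2)),\dots$ for the random basis. As in the paper, the common normalizing constant and the constant eigenfunction are omitted; this does not affect the notions above. *)

theory Defs
  imports "HOL-Probability.Probability"
begin

text \<open>All sequences of eigenfunctions are indexed by \<open>k \<ge> 1\<close>; the value at index 0 is never used.\<close>

definition amalg :: "(nat \<Rightarrow> 'a \<Rightarrow> real) \<Rightarrow> nat \<Rightarrow> 'a \<Rightarrow> 'a \<Rightarrow> real" where
  "amalg \<phi> n x y = (\<Sum>k=1..n. sgn (\<phi> k x) * \<phi> k y)"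

definition no_spooky_action :: "'a set \<Rightarrow> (nat \<Rightarrow> 'a \<Rightarrow> real) \<Rightarrow> bool" where
  "no_spooky_action M \<phi> \<longleftrightarrow>
     (\<exists>c::real. \<forall>x\<in>M. \<forall>y\<in>M. x \<noteq> y \<longrightarrow>
        (\<exists>C::real. \<forall>n\<ge>2. \<bar>amalg \<phi> n x y\<bar> \<le> C * ln (real n) powr c * sqrt (real n)))"

definition strong_spooky_action :: "'a set \<Rightarrow> (nat \<Rightarrow> 'a \<Rightarrow> real) \<Rightarrow> bool" where
  "strong_spooky_action M \<phi> \<longleftrightarrow>
     (\<exists>x\<in>M. \<exists>y\<in>M. x \<noteq> y \<and>
        limsup (\<lambda>n. ereal (\<bar>amalg \<phi> n x y\<bar> / real n)) > 0)"

text \<open>A boundary condition on \<open>[0,1]\<close> is a predicate on a function and its derivative. Derivatives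
  are taken within \<open>[0,1]\<close>, so they are one-sided at the endpoints and independent of the values
  outside the interval.\<close>

definition dirichlet :: "(real \<Rightarrow> real) \<Rightarrow> (real \<Rightarrow> real) \<Rightarrow> bool" where
  "dirichlet f f' \<longleftrightarrow> f 0 = 0 \<and> f 1 = 0"

definition neumann :: "(real \<Rightarrow> real) \<Rightarrow> (real \<Rightarrow> real) \<Rightarrow> bool" where
  "neumann f f' \<longleftrightarrow> f' 0 = 0 \<and> f' 1 = 0"

definition interval_eigenfunction ::
  "((real \<Rightarrow> real) \<Rightarrow> (real \<Rightarrow> real) \<Rightarrow> bool) \<Rightarrow> real \<Rightarrow> (real \<Rightarrow> real) \<Rightarrow> bool" where
  "interval_eigenfunction bc \<mu> f \<longleftrightarrow>
     (\<exists>x\<in>{0..1}. f x \<noteq> 0) \<and>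
     (\<exists>f'. bc f f' \<and>
        (\<forall>x\<in>{0..1}. (f has_real_derivative f' x) (at x within {0..1}) \<and>
                    (f' has_real_derivative - \<mu> * f x) (at x within {0..1})))"

text \<open>\<open>L\<^sup>2\<close>-orthonormal listing of all eigenfunctions in order of increasing eigenvalue. The last
  conjunct says that every eigenvalue occurs with its full multiplicity: its eigenspace is spanned
  by the listed eigenfunctions with that eigenvalue.\<close>

definition interval_eigenbasis ::
  "((real \<Rightarrow> real) \<Rightarrow> (real \<Rightarrow> real) \<Rightarrow> bool) \<Rightarrow> (nat \<Rightarrow> real \<Rightarrow> real) \<Rightarrow> bool" where
  "interval_eigenbasis bc \<phi> \<longleftrightarrow>
     (\<exists>\<mu> :: nat \<Rightarrow> real.
        mono_on {1..} \<mu> \<and>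
        (\<forall>k\<ge>1. interval_eigenfunction bc (\<mu> k) (\<phi> k)) \<and>
        (\<forall>j\<ge>1. \<forall>k\<ge>1. integral {0..1} (\<lambda>x. \<phi> j x * \<phi> k x) = (if j = k then 1 else 0)) \<and>
        (\<forall>\<nu> f. interval_eigenfunction bc \<nu> f \<longrightarrow>
           (\<exists>K c. finite K \<and> K \<subseteq> {k. 1 \<le> k \<and> \<mu> k = \<nu>} \<and>
                  (\<forall>x\<in>{0..1}. f x = (\<Sum>k\<in>K. c k * \<phi> k x)))))"

text \<open>The circle is \<open>[0,2\<pi>]\<close> with endpoints identified; its points are represented by
  \<open>[0,2\<pi>)\<close>.\<close>

definition circle :: "real set" where
  "circle = {0..<2 * pi}"

text \<open>The lists \<open>sin x, cos x, sin 2x, cos 2x, \<dots>\<close> and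
  \<open>sin (x - s 1), cos (x - s 1), sin (2(x - s 2)), cos (2(x - s 2)), \<dots>\<close>: positions
  \<open>2m - 1\<close> and \<open>2m\<close> carry frequency \<open>m\<close>.\<close>

definition canonical_circle_basis :: "nat \<Rightarrow> real \<Rightarrow> real" where
  "canonical_circle_basis k x =
     (let m = (k + 1) div 2 in
        if odd k then sin (real m * x) else cos (real m * x))"

definition shifted_circle_basis :: "(nat \<Rightarrow> real) \<Rightarrow> nat \<Rightarrow> real \<Rightarrow> real" where
  "shifted_circle_basis s k x =
     (let m = (k + 1) div 2 in
        if odd k then sin (real m * (x - s m)) else cos (real m * (x - s m)))"

end

theory Submission
  imports Defs
begin

text \<open>In the deterministic cases the terms \<open>sgn (\<phi> k x) * \<phi> k y\<close> are, at suitable points, a periodic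
  sequence in \<open>k\<close> with nonzero mean (up to the first term); the points are chosen with
  \<open>y = 3 x\<close>, because the square waves \<open>sgn \<circ> sin\<close> and \<open>sgn \<circ> cos\<close> correlate with their third harmonics.

  In the random case a term of frequency \<open>m\<close> has mean \<open>2 / pi * cos (m (y - x))\<close>, whose partial sums
  are bounded by the Dirichlet kernel. For \<open>x, y\<close> on a grid of mesh \<open>N\<^sup>-\<^sup>3\<close>, Hoeffding's inequality and
  the Borel-Cantelli lemma bound the deviation of the first \<open>N\<close> terms from their mean by
  \<open>4 sqrt (N ln N)\<close>. To pass to all \<open>x\<close>, the same estimate bounds the number of frequencies
  whose sign may change between \<open>x\<close> and the nearest grid point.\<close>

section \<open>Averages of periodic sequences\<close>

text \<open>The sum up to \<open>r + p * j\<close> is a constant plus \<open>j\<close> copies of the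
  sum over one period, so along this subsequence the averages tend to a positive limit, and the
  limsup dominates it. The offset \<open>r\<close> lets initial terms break the pattern, as the
  constant Neumann eigenfunction does.\<close>

lemma limsup_abs_average_pos:
  fixes f :: "nat \<Rightarrow> real"
  assumes period: "\<And>k. k > r \<Longrightarrow> f (k + p) = f k"
    and nonzero: "(\<Sum>k=r+1..r+p. f k) \<noteq> 0"
  shows "limsup (\<lambda>n. ereal (\<bar>\<Sum>k=1..n. f k\<bar> / real n)) > 0"
proof -
  define s where "s = (\<Sum>k=r+1..r+p. f k)"
  define A where "A = (\<Sum>k=1..r. f k)"
  have p: "p > 0"
    using nonzero by (cases p) auto
  have f_shift: "f (k + p * j) = f k" if "k > r" for k j
    using that period[of "k + p * _"] by (induction j) (auto simp: algebra_simps)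
  have partial: "(\<Sum>k=1..r + p * j. f k) = A + real j * s" for j
  proof (induction j)
    case 0
    then show ?case by (simp add: A_def)
  next
    case (Suc j)
    have "(\<Sum>k=1..r + p * Suc j. f k) =
        (\<Sum>k=1..r + p * j. f k) + (\<Sum>k=(r + 1) + p * j..(r + p) + p * j. f k)"
      using sum.ub_add_nat[of 1 "r + p * j" f p] by (simp add: algebra_simps)
    also have "(\<Sum>k=(r + 1) + p * j..(r + p) + p * j. f k) = (\<Sum>k=r+1..r+p. f (k + p * j))"
      by (rule sum.shift_bounds_cl_nat_ivl)
    also have "\<dots> = s"
      unfolding s_def by (intro sum.cong) (auto simp: f_shift)
    finally show ?case
      using Suc.IH by (simp add: algebra_simps)
  qed
  define u where "u j = r + p * j" for j
  have u: "strict_mono u"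
    using p by (auto simp: u_def strict_mono_def)
  let ?X = "\<lambda>n. ereal (\<bar>\<Sum>k=1..n. f k\<bar> / real n)"
  have "(\<lambda>j. \<bar>A + real j * s\<bar> / (real r + real p * real j)) \<longlonglongrightarrow> \<bar>s\<bar> / real p"
  proof -
    have "(\<lambda>j. \<bar>A / real j + s\<bar> / (real r / real j + real p)) \<longlonglongrightarrow> \<bar>0 + s\<bar> / (0 + real p)"
      using p by (intro tendsto_intros lim_const_over_n) auto
    moreover have "\<forall>\<^sub>F j in sequentially. \<bar>A / real j + s\<bar> / (real r / real j + real p) =
        \<bar>A + real j * s\<bar> / (real r + real p * real j)"
      using eventually_gt_at_top[of 0]
    proof eventually_elim
      case (elim j)
      then have j: "real j > 0" by simp
      have "\<bar>A / real j + s\<bar> = \<bar>A + real j * s\<bar> / real j"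
        using j by (subst abs_of_pos[OF j, symmetric], subst abs_divide[symmetric])
          (auto simp: field_simps)
      moreover have "real r / real j + real p = (real r + real p * real j) / real j"
        using j by (simp add: field_simps)
      ultimately show ?case
        using j by simp
    qed
    ultimately have "(\<lambda>j. \<bar>A + real j * s\<bar> / (real r + real p * real j))
        \<longlonglongrightarrow> \<bar>0 + s\<bar> / (0 + real p)"
      by (rule Lim_transform_eventually)
    then show ?thesis by simp
  qed
  then have "(?X \<circ> u) \<longlonglongrightarrow> ereal (\<bar>s\<bar> / real p)"
    using partial by (simp add: u_def o_def)
  then have "limsup (?X \<circ> u) = ereal (\<bar>s\<bar> / real p)"
    by (intro lim_imp_Limsup) auto
  moreover have "\<bar>s\<bar> / real p > 0"
    using nonzero p by (simp add: s_def)
  ultimately show ?thesis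
    using limsup_subseq_mono[OF u, of ?X] by (metis ereal_less(2) less_le_trans)
qed

section \<open>Explicit periodic sequences with nonzero mean\<close>

text \<open>For the points 1/6 and 1/2, raising \<open>k\<close> by 6 moves the arguments by
  \<open>pi\<close> and \<open>3 * pi\<close>. Both sines change sign, so the product does
  not.\<close>

lemma amalg_dirichlet_term_period:
  fixes k :: nat
  shows "sgn (sin (real (k + 6) * pi * (1/6))) * sin (real (k + 6) * pi * (1/2)) =
    sgn (sin (real k * pi * (1/6))) * sin (real k * pi * (1/2))"
proof -
  have "sin (real (k + 6) * pi * (1/6)) = sin (real k * pi * (1/6) + pi)"
    by (simp add: field_simps)
  moreover have "sin (real (k + 6) * pi * (1/2)) = sin ((real k * pi * (1/2) + pi) + 2 * pi)"
    by (simp add: field_simps)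
  ultimately show ?thesis
    by (simp only: sin_periodic sin_periodic_pi) (simp add: sgn_minus)
qed

text \<open>Even \<open>k\<close> contribute nothing because \<open>sin (k * pi / 2)\<close>
  vanishes; \<open>k = 1, 3, 5\<close> contribute 1, -1, 1, since \<open>sin (k * pi / 6)\<close> is
  positive there.\<close>

lemma amalg_dirichlet_sum:
  "(\<Sum>k=1..6. sgn (sin (real k * pi * (1/6))) * sin (real k * pi * (1/2))) = 1"
proof -
  have "sin (pi / 6) > 0" "sin (3 * pi / 6) > 0" "sin (5 * pi / 6) > 0"
    by (rule sin_gt_zero; simp)+
  moreover have "sin (3 * pi / 2) = -1" "sin (4 * pi / 2) = 0" "sin (5 * pi / 2) = 1" 
      "sin (6 * pi / 2) = 0"
    using sin_3over2_pi sin_periodic[of "pi/2"] sin_npi[of 3]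
    by (simp_all add: field_simps)
  ultimately show ?thesis
    by (simp add: numeral_eq_Suc)
qed

text \<open>The arguments move by \<open>pi\<close> and \<open>3 * pi\<close>, so again both factors
  change sign. This serves the circle at \<open>pi / 3\<close> and \<open>pi\<close> as well as the
  Neumann interval at 1/3 and 1.\<close>

lemma cos_third_pi_period:
  fixes j :: nat
  shows "sgn (cos (real (j + 3) * (pi * (1/3)))) * cos (real (j + 3) * pi) =
    sgn (cos (real j * (pi * (1/3)))) * cos (real j * pi)"
proof -
  have "cos (real (j + 3) * (pi * (1/3))) = cos (real j * (pi * (1/3)) + pi)"
    by (simp add: field_simps)
  moreover have "cos (real (j + 3) * pi) = cos ((real j * pi + pi) + 2 * pi)"
    by (simp add: field_simps)
  ultimately show ?thesis
    by (simp only: cos_periodic cos_periodic_pi) (simp add: sgn_minus)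
qed

lemma cos_third_pi_values:
  "sgn (cos (real 1 * (pi * (1/3)))) * cos (real 1 * pi) = -1"
  "sgn (cos (real 2 * (pi * (1/3)))) * cos (real 2 * pi) = -1"
  "sgn (cos (real 3 * (pi * (1/3)))) * cos (real 3 * pi) = 1"
  using cos_npi[of 2] cos_npi[of 3]
  by (simp_all add: cos_60 cos_120)

lemma strong_spooky_canonical_circle: "strong_spooky_action circle canonical_circle_basis"
proof -
  let ?x = "pi * (1/3)"
  define f where "f k = sgn (canonical_circle_basis k ?x) * canonical_circle_basis k pi" for k
  \<comment> \<open>At \<open>y = pi\<close> every sine term vanishes, which leaves the cosines at
    even positions. The period 3 in the frequency becomes 6 in the position.\<close>
  have f: "f k = (if odd k then 0 else
      sgn (cos (real (k div 2) * (pi * (1/3)))) * cos (real (k div 2) * pi))" for k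
    using sin_npi[of "Suc (k div 2)"] by (auto simp: f_def canonical_circle_basis_def Let_def)
  have "f (k + 6) = f k" for k
    using cos_third_pi_period[of "k div 2"] by (simp add: f)
  moreover have "(\<Sum>k=0+1..0+6. f k) = -1"
  proof -
    have "{0+1..0+6::nat} = {1,2,3,4,5,6}" by auto
    then show ?thesis
      using cos_third_pi_values by (simp add: f)
  qed
  ultimately have "limsup (\<lambda>n. ereal (\<bar>\<Sum>k=1..n. f k\<bar> / real n)) > 0"
    by (intro limsup_abs_average_pos[of 0 f 6]) auto
  then show ?thesis
    unfolding strong_spooky_action_def amalg_def f_def
    by (intro bexI[of _ ?x] bexI[of _ pi]) (auto simp: circle_def)
qed

section \<open>Eigenfunctions of the interval\<close>

text \<open>The derivative of \<open>f * f'\<close> is \<open>f'^2 - \<mu> * f^2\<close>, and its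
  integral is zero by the boundary values. For \<open>\<mu> \<le> 0\<close> both summands are
  nonnegative and continuous, hence zero everywhere. Stating the boundary hypothesis for products
  covers Dirichlet and Neumann at once.\<close>

lemma eigenfunction_nonpos:
  fixes f f' :: "real \<Rightarrow> real"
  assumes df: "\<And>x. x \<in> {0..1} \<Longrightarrow> (f has_real_derivative f' x) (at x within {0..1})"
    and df': "\<And>x. x \<in> {0..1} \<Longrightarrow> (f' has_real_derivative - \<mu> * f x) (at x within {0..1})"
    and bc: "f 0 * f' 0 = 0" "f 1 * f' 1 = 0"
    and \<mu>: "\<mu> \<le> 0" and x: "x \<in> {0..1}"
  shows "f' x = 0" "\<mu> * f x = 0"
proof -
  let ?h = "\<lambda>x. (f' x)\<^sup>2 + (- \<mu>) * (f x)\<^sup>2"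
  have int: "(?h has_integral f 1 * f' 1 - f 0 * f' 0) {0..1}"
  proof (rule fundamental_theorem_of_calculus)
    fix x :: real assume x: "x \<in> {0..1}"
    have "((\<lambda>x. f x * f' x) has_real_derivative ?h x) (at x within {0..1})"
      by (auto intro!: derivative_eq_intros df[OF x] df'[OF x] simp: power2_eq_square)
    then show "((\<lambda>x. f x * f' x) has_vector_derivative ?h x) (at x within {0..1})"
      by (simp add: has_real_derivative_iff_has_vector_derivative)
  qed simp
  have "continuous_on {0..1} f" "continuous_on {0..1} f'"
    using DERIV_continuous_on[OF df] DERIV_continuous_on[OF df'] by simp_all
  then have cont: "continuous_on {0..1} ?h"
    by (intro continuous_intros)
  have nonneg: "0 \<le> (f' y)\<^sup>2" "0 \<le> (- \<mu>) * (f y)\<^sup>2" for y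
    using \<mu> by (simp_all add: mult_nonpos_nonneg)
  then have "0 \<le> ?h y" for y
    by (intro add_nonneg_nonneg) auto
  then have "?h x = 0"
    using has_integral_0_cbox_imp_0[of 0 1 ?h x] int cont x bc by simp
  then have "(f' x)\<^sup>2 = 0" "(- \<mu>) * (f x)\<^sup>2 = 0"
    using nonneg[of x] by linarith+
  then show "f' x = 0" "\<mu> * f x = 0"
    by simp_all
qed

text \<open>Variation of constants: the coefficients of \<open>f\<close> in the fundamental system
  \<open>cos (\<omega> x), sin (\<omega> x)\<close> have derivative zero.\<close>

lemma harmonic_oscillator:
  fixes f f' :: "real \<Rightarrow> real"
  assumes df: "\<And>x. x \<in> {0..1} \<Longrightarrow> (f has_real_derivative f' x) (at x within {0..1})"
    and df': "\<And>x. x \<in> {0..1} \<Longrightarrow> (f' has_real_derivative - (\<omega>\<^sup>2) * f x) (at x within {0..1})"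
    and \<omega>: "\<omega> \<noteq> 0"
  obtains a b where "\<And>x. x \<in> {0..1} \<Longrightarrow> f x = a * cos (\<omega> * x) + b * sin (\<omega> * x)"
    "\<And>x. x \<in> {0..1} \<Longrightarrow> f' x = \<omega> * (b * cos (\<omega> * x) - a * sin (\<omega> * x))"
proof -
  let ?u = "\<lambda>x. f x * cos (\<omega> * x) - f' x * sin (\<omega> * x) / \<omega>"
  let ?v = "\<lambda>x. f x * sin (\<omega> * x) + f' x * cos (\<omega> * x) / \<omega>"
  have "(?u has_real_derivative 0) (at x within {0..1})" if x: "x \<in> {0..1}" for x
    using \<omega> by (auto intro!: derivative_eq_intros df[OF x] df'[OF x] 
      simp: field_simps power2_eq_square)
  then obtain a where a: "\<And>x. x \<in> {0..1} \<Longrightarrow> ?u x = a"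
    using has_field_derivative_zero_constant[of "{0..1}" ?u] by auto
  have "(?v has_real_derivative 0) (at x within {0..1})" if x: "x \<in> {0..1}" for x
    using \<omega> by (auto intro!: derivative_eq_intros df[OF x] df'[OF x]
      simp: field_simps power2_eq_square)
  then obtain b where b: "\<And>x. x \<in> {0..1} \<Longrightarrow> ?v x = b"
    using has_field_derivative_zero_constant[of "{0..1}" ?v] by auto
  \<comment> \<open>The coefficients \<open>?u\<close>, \<open>?v\<close> arise from
    \<open>(f, f' / \<omega>)\<close> by a rotation through the angle \<open>\<omega> * x\<close>;
    rotating back recovers \<open>f\<close> and \<open>f'\<close>.\<close>
  have rotate: "C * (p * C - q * S / \<omega>) + S * (p * S + q * C / \<omega>) = p"
    "C * (p * S + q * C / \<omega>) - S * (p * C - q * S / \<omega>) = q / \<omega>"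
    if "S\<^sup>2 + C\<^sup>2 = 1" for C S p q :: real
  proof -
    have "C * (p * C - q * S / \<omega>) + S * (p * S + q * C / \<omega>) = p * (S\<^sup>2 + C\<^sup>2)"
      by (simp add: algebra_simps power2_eq_square)
    then show "C * (p * C - q * S / \<omega>) + S * (p * S + q * C / \<omega>) = p"
      using that by simp
    have "C * (p * S + q * C / \<omega>) - S * (p * C - q * S / \<omega>) = q / \<omega> * (S\<^sup>2 + C\<^sup>2)"
      by (simp add: algebra_simps power2_eq_square)
    then show "C * (p * S + q * C / \<omega>) - S * (p * C - q * S / \<omega>) = q / \<omega>"
      using that by simp
  qed
  show thesis
  proof (rule that[of a b])
    fix x :: real assume x: "x \<in> {0..1}"
    note r = rotate[where S = "sin (\<omega> * x)" and C = "cos (\<omega> * x)" and p = "f x" and q = "f' x",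
        OF sin_cos_squared_add]
    show "f x = a * cos (\<omega> * x) + b * sin (\<omega> * x)"
      using r(1) a[OF x] b[OF x] by (simp add: mult.commute)
    show "f' x = \<omega> * (b * cos (\<omega> * x) - a * sin (\<omega> * x))"
      using r(2) a[OF x] b[OF x] \<omega> by (simp add: field_simps)
  qed
qed

lemma sin_zero_pos_frequency:
  assumes "sin \<omega> = 0" "\<omega> > 0"
  obtains j :: nat where "j \<ge> 1" "\<omega> = real j * pi"
proof -
  obtain i :: int where i: "\<omega> = of_int i * pi"
    using assms(1) by (auto simp: sin_zero_iff_int2)
  then have "i > 0"
    using assms(2) by (simp add: zero_less_mult_iff)
  then show thesis
    using i by (intro that[of "nat i"]) auto
qed

text \<open>The boundary value at 0 removes the cosine, and the one at 1 makes
  \<open>sqrt \<mu>\<close> a zero of the sine.\<close>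

lemma dirichlet_eigenfunction_cases:
  assumes "interval_eigenfunction dirichlet \<mu> f"
  obtains j :: nat and b where "j \<ge> 1" "\<mu> = (real j * pi)\<^sup>2"
    "\<And>x. x \<in> {0..1} \<Longrightarrow> f x = b * sin (real j * pi * x)"
proof -
  obtain x0 where x0: "x0 \<in> {0..1}" "f x0 \<noteq> 0"
    using assms unfolding interval_eigenfunction_def by blast
  obtain f' where bc: "f 0 = 0" "f 1 = 0"
    and df: "\<And>x. x \<in> {0..1} \<Longrightarrow> (f has_real_derivative f' x) (at x within {0..1})"
    and df': "\<And>x. x \<in> {0..1} \<Longrightarrow> (f' has_real_derivative - \<mu> * f x) (at x within {0..1})"
    using assms unfolding interval_eigenfunction_def dirichlet_def by blast
  \<comment> \<open>Otherwise \<open>f\<close> would be constant, hence zero by its boundary value,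
    although \<open>f x0 \<noteq> 0\<close>.\<close>
  have "\<mu> > 0"
  proof (rule ccontr)
    assume "\<not> \<mu> > 0"
    then have "f' x = 0" if "x \<in> {0..1}" for x
      using eigenfunction_nonpos(1)[OF df df'] bc that by auto
    then obtain c where "\<And>x. x \<in> {0..1} \<Longrightarrow> f x = c"
      using has_field_derivative_zero_constant[of "{0..1}" f] df by fastforce
    then show False
      using x0 bc by force
  qed
  then have \<omega>: "sqrt \<mu> > 0" "\<mu> = (sqrt \<mu>)\<^sup>2"
    by simp_all
  obtain a b where ab: "\<And>x. x \<in> {0..1} \<Longrightarrow> f x = a * cos (sqrt \<mu> * x) + b * sin (sqrt \<mu> * x)"
    using harmonic_oscillator[of f f' "sqrt \<mu>"] df df' \<omega> by (metis less_irrefl)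
  have a: "a = 0"
    using ab[of 0] bc by simp
  then have "b \<noteq> 0"
    using ab x0 by auto
  then have "sin (sqrt \<mu>) = 0"
    using ab[of 1] bc a by simp
  then obtain j :: nat where j: "j \<ge> 1" "sqrt \<mu> = real j * pi"
    using sin_zero_pos_frequency \<omega> by blast
  show thesis
    using ab a j \<omega> by (intro that[of j b]) auto
qed

text \<open>The slope at 0 removes the sine, and the slope at 1 makes \<open>sqrt \<mu>\<close> a
  zero of the sine. The case \<open>j = 0\<close> stands for the constants.\<close>

lemma neumann_eigenfunction_cases:
  assumes "interval_eigenfunction neumann \<mu> f"
  obtains j :: nat and a where "\<mu> = (real j * pi)\<^sup>2"
    "\<And>x. x \<in> {0..1} \<Longrightarrow> f x = a * cos (real j * pi * x)"
proof -
  obtain x0 where x0: "x0 \<in> {0..1}" "f x0 \<noteq> 0"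
    using assms unfolding interval_eigenfunction_def by blast
  obtain f' where bc: "f' 0 = 0" "f' 1 = 0"
    and df: "\<And>x. x \<in> {0..1} \<Longrightarrow> (f has_real_derivative f' x) (at x within {0..1})"
    and df': "\<And>x. x \<in> {0..1} \<Longrightarrow> (f' has_real_derivative - \<mu> * f x) (at x within {0..1})"
    using assms unfolding interval_eigenfunction_def neumann_def by blast
  show thesis
  proof (cases "\<mu> > 0")
    case False
    then have *: "f' x = 0" "\<mu> * f x = 0" if "x \<in> {0..1}" for x
      using eigenfunction_nonpos[OF df df'] bc that by auto
    then obtain c where "\<And>x. x \<in> {0..1} \<Longrightarrow> f x = c"
      using has_field_derivative_zero_constant[of "{0..1}" f] df by fastforce
    \<comment> \<open>Since \<open>\<mu> * f x0 = 0\<close> with \<open>f x0 \<noteq> 0\<close>, the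
      only nonpositive eigenvalue is 0.\<close>
    moreover have "\<mu> = 0"
      using *(2)[of x0] x0 by simp
    ultimately show thesis
      by (intro that[of 0 c]) auto
  next
    case True
    then have \<omega>: "sqrt \<mu> > 0" "\<mu> = (sqrt \<mu>)\<^sup>2"
      by simp_all
    obtain a b where ab: "\<And>x. x \<in> {0..1} \<Longrightarrow> f x = a * cos (sqrt \<mu> * x) + b * sin (sqrt \<mu> * x)"
      "\<And>x. x \<in> {0..1} \<Longrightarrow> f' x = sqrt \<mu> * (b * cos (sqrt \<mu> * x) - a * sin (sqrt \<mu> * x))"
      using harmonic_oscillator[of f f' "sqrt \<mu>"] df df' \<omega> by (metis less_irrefl)
    have b: "b = 0"
      using ab(2)[of 0] bc \<omega> by simp
    then have "a \<noteq> 0"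
      using ab x0 by auto
    then have "sin (sqrt \<mu>) = 0"
      using ab(2)[of 1] bc b \<omega> by simp
    then obtain j :: nat where j: "j \<ge> 1" "sqrt \<mu> = real j * pi"
      using sin_zero_pos_frequency \<omega> by blast
    show thesis
      using ab(1) b j \<omega> by (intro that[of j a]) auto
  qed
qed

lemma interval_eigenfunction_sin:
  assumes "j \<ge> 1" "c \<noteq> 0"
  shows "interval_eigenfunction dirichlet ((real j * pi)\<^sup>2) (\<lambda>x. c * sin (real j * pi * x))"
proof -
  let ?f' = "\<lambda>x. c * (real j * pi) * cos (real j * pi * x)"
  \<comment> \<open>The top of the first arch, where the sine equals 1, witnesses that the function
    is not zero.\<close>
  have "1 / (2 * real j) \<in> {0..1}" "sin (real j * pi * (1 / (2 * real j))) \<noteq> 0"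
    using assms by auto
  then show ?thesis
    unfolding interval_eigenfunction_def dirichlet_def using assms(2)
    by (intro conjI exI[of _ ?f'] ballI bexI[of _ "1 / (2 * real j)"])
      (auto intro!: derivative_eq_intros simp: power2_eq_square)
qed

lemma interval_eigenfunction_cos:
  assumes "c \<noteq> 0"
  shows "interval_eigenfunction neumann ((real j * pi)\<^sup>2) (\<lambda>x. c * cos (real j * pi * x))"
proof -
  let ?f' = "\<lambda>x. - c * (real j * pi) * sin (real j * pi * x)"
  show ?thesis
    unfolding interval_eigenfunction_def neumann_def using assms
    by (intro conjI exI[of _ ?f'] ballI bexI[of _ 0])
      (auto intro!: derivative_eq_intros simp: power2_eq_square)
qed

lemma has_integral_sin_squared:
  assumes "j \<ge> 1"
  shows "((\<lambda>x. (sqrt 2 * sin (real j * pi * x)) * (sqrt 2 * sin (real j * pi * x)))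
    has_integral 1) {0..1}"
proof -
  let ?F = "\<lambda>x. x - sin (2 * (real j * pi * x)) / (2 * real j * pi)"
  have "((\<lambda>x. (sqrt 2 * sin (real j * pi * x)) * (sqrt 2 * sin (real j * pi * x)))
      has_integral ?F 1 - ?F 0) {0..1}"
  proof (rule fundamental_theorem_of_calculus)
    fix x :: real
    have "(?F has_real_derivative 1 - cos (2 * (real j * pi * x))) (at x within {0..1})"
      using assms by (auto intro!: derivative_eq_intros)
    also have "1 - cos (2 * (real j * pi * x)) =
        (sqrt 2 * sin (real j * pi * x)) * (sqrt 2 * sin (real j * pi * x))"
      unfolding cos_double_sin by (simp add: power2_eq_square algebra_simps)
    finally show "(?F has_vector_derivative
        (sqrt 2 * sin (real j * pi * x)) * (sqrt 2 * sin (real j * pi * x))) (at x within {0..1})"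
      by (simp add: has_real_derivative_iff_has_vector_derivative)
  qed simp
  moreover have "sin (2 * (real j * pi)) = 0"
    using sin_npi[of "2 * j"] by (simp add: mult.assoc)
  ultimately show ?thesis by simp
qed

lemma has_integral_cos_squared:
  assumes "j \<ge> 1"
  shows "((\<lambda>x. (sqrt 2 * cos (real j * pi * x)) * (sqrt 2 * cos (real j * pi * x)))
    has_integral 1) {0..1}"
proof -
  have "((\<lambda>x. 2 - (sqrt 2 * sin (real j * pi * x)) * (sqrt 2 * sin (real j * pi * x)))
      has_integral (2 - 1)) {0..1}"
    using has_integral_const_real[of "2::real" 0 1]
    by (intro has_integral_diff has_integral_sin_squared[OF assms]) simp
  moreover have "2 - (sqrt 2 * sin t) * (sqrt 2 * sin t) = (sqrt 2 * cos t) * (sqrt 2 * cos t)" for t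
  proof -
    have "(sqrt 2 * z) * (sqrt 2 * z) = 2 * z\<^sup>2" for z
      by (simp add: power2_eq_square algebra_simps)
    then show ?thesis
      using sin_cos_squared_add[of t] by (simp only:)
  qed
  ultimately show ?thesis
    by simp
qed

section \<open>Rigidity of eigenbases with simple spectrum\<close>

text \<open>By strong induction all smaller indices are fixed. So the preimage of \<open>k\<close>
  is at least \<open>k\<close>, giving \<open>\<sigma> k \<le> k\<close>; and a value
  \<open>\<sigma> k < k\<close> would be fixed itself, against strictness.\<close>

lemma strict_mono_on_surj_eq_self:
  fixes \<sigma> :: "nat \<Rightarrow> nat"
  assumes mono: "\<And>i j. 1 \<le> i \<Longrightarrow> i < j \<Longrightarrow> \<sigma> i < \<sigma> j"
    and surj: "\<And>j. 1 \<le> j \<Longrightarrow> \<exists>i\<ge>1. \<sigma> i = j"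
    and pos: "\<And>i. 1 \<le> i \<Longrightarrow> 1 \<le> \<sigma> i"
    and k: "1 \<le> k"
  shows "\<sigma> k = k"
  using k
proof (induction k rule: less_induct)
  case (less k)
  obtain i where i: "i \<ge> 1" "\<sigma> i = k"
    using surj less.prems by blast
  have "k \<le> i"
  proof (rule ccontr)
    assume "\<not> k \<le> i"
    then show False
      using less.IH[of i] i by simp
  qed
  then have "\<sigma> k \<le> k"
    using mono[of k i] less.prems i by (metis le_neq_implies_less less_imp_le)
  moreover have "\<not> \<sigma> k < k"
    using less.IH[of "\<sigma> k"] mono[of "\<sigma> k" k] pos[of k] less.prems by auto
  ultimately show ?case by simp
qed

text \<open>Each \<open>\<phi> k\<close> is a multiple of some \<open>\<psi> (\<sigma> k)\<close>.
  Orthogonality makes \<open>\<sigma>\<close> injective, the ordering of eigenvalues makes it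
  increasing and completeness makes it onto, so it is the identity; normalization then leaves only a
  sign.\<close>

lemma eigenbasis_unique:
  assumes basis: "interval_eigenbasis bc \<phi>"
    and \<nu>: "\<And>i j. 1 \<le> i \<Longrightarrow> i < j \<Longrightarrow> \<nu> i < (\<nu> j :: real)"
    and cases: "\<And>\<mu> f. interval_eigenfunction bc \<mu> f \<Longrightarrow>
      \<exists>j\<ge>1. \<exists>a. \<mu> = \<nu> j \<and> (\<forall>x\<in>{0..1}. f x = a * \<psi> j x)"
    and eigen: "\<And>j. 1 \<le> j \<Longrightarrow> interval_eigenfunction bc (\<nu> j) (\<psi> j)"
    and normal: "\<And>j. 1 \<le> j \<Longrightarrow> ((\<lambda>x. \<psi> j x * \<psi> j x) has_integral 1) {0..1}"
    and k: "1 \<le> k"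
  shows "\<exists>a. \<bar>a\<bar> = 1 \<and> (\<forall>x\<in>{0..1}. \<phi> k x = a * \<psi> k x)"
proof -
  from basis obtain \<mu> :: "nat \<Rightarrow> real" where
    mono: "mono_on {1..} \<mu>"
    and ef: "\<And>k. 1 \<le> k \<Longrightarrow> interval_eigenfunction bc (\<mu> k) (\<phi> k)"
    and orth: "\<And>j k. 1 \<le> j \<Longrightarrow> 1 \<le> k \<Longrightarrow>
      integral {0..1} (\<lambda>x. \<phi> j x * \<phi> k x) = (if j = k then 1 else 0)"
    and full: "\<And>\<nu> f. interval_eigenfunction bc \<nu> f \<Longrightarrow>
      \<exists>K c. finite K \<and> K \<subseteq> {k. 1 \<le> k \<and> \<mu> k = \<nu>} \<and> (\<forall>x\<in>{0..1}. f x = (\<Sum>k\<in>K. c k * \<phi> k x))"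
    unfolding interval_eigenbasis_def by blast
  have "\<forall>k. \<exists>j a. 1 \<le> k \<longrightarrow> 1 \<le> j \<and> \<mu> k = \<nu> j \<and> (\<forall>x\<in>{0..1}. \<phi> k x = a * \<psi> j x)"
    using cases[OF ef] by meson
  then obtain \<sigma> a where \<sigma>: "\<And>k. 1 \<le> k \<Longrightarrow> 1 \<le> \<sigma> k \<and> \<mu> k = \<nu> (\<sigma> k)"
    and a: "\<And>k x. 1 \<le> k \<Longrightarrow> x \<in> {0..1} \<Longrightarrow> \<phi> k x = a k * \<psi> (\<sigma> k) x"
    by metis
  have int: "integral {0..1} (\<lambda>x. \<phi> i x * \<phi> j x) = a i * a j" if "1 \<le> i" "1 \<le> j" "\<sigma> i = \<sigma> j" for i j
  proof -
    have "((\<lambda>x. a i * a j * (\<psi> (\<sigma> j) x * \<psi> (\<sigma> j) x)) has_integral a i * a j * 1) {0..1}"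
      using \<sigma> that by (intro has_integral_mult_right normal) auto
    then have "((\<lambda>x. \<phi> i x * \<phi> j x) has_integral a i * a j * 1) {0..1}"
      by (rule has_integral_eq[rotated]) (use a that in auto)
    then show ?thesis by (simp add: integral_unique)
  qed
  have a_unit: "a i * a i = 1" if "1 \<le> i" for i
    using int[of i i] orth[of i i] that by simp
  have \<sigma>_id: "\<sigma> k = k" if "1 \<le> k" for k
  proof (rule strict_mono_on_surj_eq_self[OF _ _ _ that])
    fix i j :: nat assume ij: "1 \<le> i" "i < j"
    \<comment> \<open>Two positions sharing one \<open>\<psi>\<close> would have inner product
      \<open>a i * a j\<close>, which has absolute value 1 instead of 0.\<close>
    have "\<sigma> i \<noteq> \<sigma> j"
    proof
      assume "\<sigma> i = \<sigma> j"
      then have "a i * a j = 0"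
        using int[of i j] orth[of i j] ij by simp
      then show False
        using a_unit[of i] a_unit[of j] ij by auto
    qed
    moreover have "\<mu> i \<le> \<mu> j"
      using mono ij by (auto simp: mono_on_def)
    then have "\<not> \<sigma> j < \<sigma> i"
      using \<nu>[of "\<sigma> j" "\<sigma> i"] \<sigma>[of i] \<sigma>[of j] ij by auto
    ultimately show "\<sigma> i < \<sigma> j" by simp
  next
    fix j :: nat assume j: "1 \<le> j"
    obtain K c where K: "K \<subseteq> {k. 1 \<le> k \<and> \<mu> k = \<nu> j}"
      and sum: "\<And>x. x \<in> {0..1} \<Longrightarrow> \<psi> j x = (\<Sum>k\<in>K. c k * \<phi> k x)"
      using full[OF eigen[OF j]] by blast
    obtain x where "x \<in> {0..1}" "\<psi> j x \<noteq> 0"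
      using eigen[OF j] unfolding interval_eigenfunction_def by blast
    \<comment> \<open>A nonzero \<open>\<psi> j\<close> cannot be an empty combination, so its
      eigenvalue does occur in the list.\<close>
    then have "K \<noteq> {}"
      using sum[of x] by auto
    then obtain i where i: "1 \<le> i" "\<mu> i = \<nu> j"
      using K by auto
    then have "\<nu> (\<sigma> i) = \<nu> j" "1 \<le> \<sigma> i"
      using \<sigma>[of i] by auto
    then have "\<sigma> i = j"
      using \<nu>[of "\<sigma> i" j] \<nu>[of j "\<sigma> i"] j by (metis less_irrefl nat_neq_iff)
    then show "\<exists>i\<ge>1. \<sigma> i = j"
      using i by blast
  qed (use \<sigma> in auto)
  have "a k = 1 \<or> a k = -1"
    using a_unit[OF k] by (simp add: square_eq_1_iff)
  then have "\<bar>a k\<bar> = 1"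
    by auto
  then show ?thesis
    using a[OF k] \<sigma>_id[OF k] by (intro exI[of _ "a k"]) auto
qed

text \<open>A sign \<open>a\<close> enters each term twice, through \<open>sgn\<close> and through
  the value, and cancels.\<close>

lemma strong_spooky_action_cong:
  assumes unit: "\<And>k. 1 \<le> k \<Longrightarrow> \<exists>a. \<bar>a\<bar> = 1 \<and> (\<forall>x\<in>M. \<phi> k x = a * \<psi> k x)"
    and x: "x \<in> M" and y: "y \<in> M" and "x \<noteq> y"
    and limsup: "limsup (\<lambda>n. ereal (\<bar>\<Sum>k=1..n. sgn (\<psi> k x) * \<psi> k y\<bar> / real n)) > 0"
  shows "strong_spooky_action M \<phi>"
proof -
  have "sgn (\<phi> k x) * \<phi> k y = sgn (\<psi> k x) * \<psi> k y" if k: "1 \<le> k" for k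
  proof -
    obtain a where a: "\<bar>a\<bar> = 1" "\<forall>x\<in>M. \<phi> k x = a * \<psi> k x"
      using unit[OF k] by blast
    then have "a = 1 \<or> a = -1"
      by auto
    then show ?thesis
      using a x y by (auto simp: sgn_minus)
  qed
  then have "amalg \<phi> n x y = (\<Sum>k=1..n. sgn (\<psi> k x) * \<psi> k y)" for n
    unfolding amalg_def by (intro sum.cong) auto
  then show ?thesis
    unfolding strong_spooky_action_def
    by (intro bexI[OF _ x] bexI[OF _ y] conjI) (simp_all only: limsup \<open>x \<noteq> y\<close> not_False_eq_True)
qed

lemma strong_spooky_dirichlet:
  assumes "interval_eigenbasis dirichlet \<phi>"
  shows "strong_spooky_action {0..1} \<phi>"
proof -
  define \<psi> where "\<psi> k x = sqrt 2 * sin (real k * pi * x)" for k x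
  have unit: "\<exists>a. \<bar>a\<bar> = 1 \<and> (\<forall>x\<in>{0..1}. \<phi> k x = a * \<psi> k x)" if "1 \<le> k" for k
  proof (rule eigenbasis_unique[where \<nu> = "\<lambda>j. (real j * pi)\<^sup>2", OF assms])
    show "(real i * pi)\<^sup>2 < (real j * pi)\<^sup>2" if "1 \<le> i" "i < j" for i j
      using that by (intro power_strict_mono) auto
    fix \<mu> f assume "interval_eigenfunction dirichlet \<mu> f"
    then obtain j :: nat and b where "j \<ge> 1" "\<mu> = (real j * pi)\<^sup>2"
      "\<And>x. x \<in> {0..1} \<Longrightarrow> f x = b * sin (real j * pi * x)"
      using dirichlet_eigenfunction_cases by metis
    then show "\<exists>j\<ge>1. \<exists>a. \<mu> = (real j * pi)\<^sup>2 \<and> (\<forall>x\<in>{0..1}. f x = a * \<psi> j x)"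
      by (intro exI[of _ j] conjI exI[of _ "b / sqrt 2"]) (auto simp: \<psi>_def)
  next
    fix j :: nat assume "1 \<le> j"
    then show "interval_eigenfunction dirichlet ((real j * pi)\<^sup>2) (\<psi> j)"
      "((\<lambda>x. \<psi> j x * \<psi> j x) has_integral 1) {0..1}"
      unfolding \<psi>_def using interval_eigenfunction_sin[of j "sqrt 2"] has_integral_sin_squared[of j]
      by simp_all
  qed fact
  define f where "f k = sgn (\<psi> k (1/6)) * \<psi> k (1/2)" for k
  have f: "f k = sqrt 2 * (sgn (sin (real k * pi * (1/6))) * sin (real k * pi * (1/2)))" for k
    by (simp add: f_def \<psi>_def sgn_mult)
  have "(\<Sum>k=0+1..0+6. f k) = sqrt 2"
    using amalg_dirichlet_sum unfolding f sum_distrib_left[symmetric] by simp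
  moreover have "f (k + 6) = f k" for k
    unfolding f amalg_dirichlet_term_period ..
  ultimately have "limsup (\<lambda>n. ereal (\<bar>\<Sum>k=1..n. f k\<bar> / real n)) > 0"
    by (intro limsup_abs_average_pos[of 0 f 6]) auto
  then show ?thesis
    by (intro strong_spooky_action_cong[where x = "1/6" and y = "1/2", OF unit]) (auto simp: f_def)
qed

lemma strong_spooky_neumann:
  assumes "interval_eigenbasis neumann \<phi>"
  shows "strong_spooky_action {0..1} \<phi>"
proof -
  define c where "c k = (if k = 1 then 1 else sqrt 2)" for k :: nat
  \<comment> \<open>Position \<open>k\<close> carries frequency \<open>k - 1\<close>; position 1 is
    the constant, whose norm needs no factor \<open>sqrt 2\<close>.\<close>
  define \<psi> where "\<psi> k x = c k * cos (real (k - 1) * pi * x)" for k x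
  have c: "c k > 0" for k
    by (simp add: c_def)
  have unit: "\<exists>a. \<bar>a\<bar> = 1 \<and> (\<forall>x\<in>{0..1}. \<phi> k x = a * \<psi> k x)" if "1 \<le> k" for k
  proof (rule eigenbasis_unique[where \<nu> = "\<lambda>j. (real (j - 1) * pi)\<^sup>2", OF assms])
    show "(real (i - 1) * pi)\<^sup>2 < (real (j - 1) * pi)\<^sup>2" if "1 \<le> i" "i < j" for i j
      using that by (intro power_strict_mono) auto
    fix \<mu> f assume "interval_eigenfunction neumann \<mu> f"
    then obtain j :: nat and a where "\<mu> = (real j * pi)\<^sup>2"
      "\<And>x. x \<in> {0..1} \<Longrightarrow> f x = a * cos (real j * pi * x)"
      using neumann_eigenfunction_cases by metis
    then show "\<exists>j\<ge>1. \<exists>a. \<mu> = (real (j - 1) * pi)\<^sup>2 \<and> (\<forall>x\<in>{0..1}. f x = a * \<psi> j x)"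
      using c[of "j + 1"]
      by (intro exI[of _ "j + 1"] conjI exI[of _ "a / c (j + 1)"]) (auto simp: \<psi>_def)
  next
    fix j :: nat assume j: "1 \<le> j"
    show "interval_eigenfunction neumann ((real (j - 1) * pi)\<^sup>2) (\<psi> j)"
      unfolding \<psi>_def using interval_eigenfunction_cos[of "c j" "j - 1"] c[of j] by simp
    show "((\<lambda>x. \<psi> j x * \<psi> j x) has_integral 1) {0..1}"
    proof (cases "j = 1")
      case True
      then show ?thesis
        using has_integral_const_real[of "1::real" 0 1] by (simp add: \<psi>_def c_def)
    next
      case False
      then show ?thesis
        unfolding \<psi>_def c_def using has_integral_cos_squared[of "j - 1"] j by simp
    qed
  qed fact
  define g where "g j = sgn (cos (real j * (pi * (1/3)))) * cos (real j * pi)" for j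
  define f where "f k = sgn (\<psi> k (1/3)) * \<psi> k 1" for k
  \<comment> \<open>The first term lacks the factor \<open>sqrt 2\<close>, so periodicity is used
    only from \<open>k = 2\<close> on, with offset \<open>r = 1\<close>.\<close>
  have f: "f k = sqrt 2 * g (k - 1)" if "k > 1" for k
    using that by (simp add: f_def g_def \<psi>_def c_def sgn_mult)
  have "{1+1..1+3::nat} = {2,3,4}" by auto
  then have "(\<Sum>k=1+1..1+3. f k) = - sqrt 2"
    using cos_third_pi_values unfolding g_def[symmetric] by (simp add: f)
  moreover have "f (k + 3) = f k" if "k > 1" for k
    using cos_third_pi_period[of "k - 1"] that unfolding g_def[symmetric] by (simp add: f)
  ultimately have "limsup (\<lambda>n. ereal (\<bar>\<Sum>k=1..n. f k\<bar> / real n)) > 0"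
    by (intro limsup_abs_average_pos[of 1 f 3]) auto
  then show ?thesis
    by (intro strong_spooky_action_cong[where x = "1/3" and y = 1, OF unit]) (auto simp: f_def)
qed

section \<open>Uniform random phases\<close>

lemma integral_shift_interval:
  fixes g :: "real \<Rightarrow> real"
  shows "integral {c + d..e + d} g = integral {c..e} (\<lambda>x. g (x + d))"
proof -
  have "(g has_integral I) {c + d..e + d} \<longleftrightarrow> ((\<lambda>x. g (x + d)) has_integral I) {c..e}" for I
    using has_integral_affinity_iff[of 1 g d I "c + d" "e + d"] by simp
  \<comment> \<open>The equivalence of the \<open>has_integral\<close> statements also matches the
    default values when \<open>g\<close> is not integrable.\<close>
  then show ?thesis
    by (simp add: integral_def integrable_on_def)
qed

text \<open>Cut the interval at the multiple \<open>c\<close> of \<open>T\<close> that it contains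
  and move the left piece by one period to the right end. The result is the interval from
  \<open>c\<close> to \<open>c + T\<close>, which shifts to the one starting at 0.\<close>

lemma integral_period:
  fixes g :: "real \<Rightarrow> real"
  assumes period: "\<And>x. g (x + T) = g x" and T: "T > 0"
    and int: "\<And>a b. g integrable_on {a..b}"
  shows "integral {a..a + T} g = integral {0..T} g"
proof -
  have shift_nat: "g (x + real n * T) = g x" for x n
  proof (induction n)
    case (Suc n)
    have "g (x + real (Suc n) * T) = g ((x + real n * T) + T)"
      by (simp add: algebra_simps)
    then show ?case
      by (simp only: period Suc)
  qed simp
  have shift_int: "g (x + of_int k * T) = g x" for x k
  proof (cases "k \<ge> 0")
    case True
    then show ?thesis
      using shift_nat[of x "nat k"] by simp
  next
    case False
    then show ?thesis
      using shift_nat[of "x + of_int k * T" "nat (- k)"] by simp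
  qed
  define k where "k = \<lceil>a / T\<rceil>"
  define c where "c = of_int k * T"
  have "a / T \<le> of_int k" "of_int k < a / T + 1"
    unfolding k_def by linarith+
  then have c: "a \<le> c" "c \<le> a + T"
    using T by (auto simp: c_def field_simps)
  have "integral {a..a + T} g = integral {a..c} g + integral {c..a + T} g"
    using c int by (intro Henstock_Kurzweil_Integration.integral_combine[symmetric]) auto
  also have "integral {a..c} g = integral {a + T..c + T} g"
    by (simp add: integral_shift_interval period)
  also have "\<dots> + integral {c..a + T} g = integral {c..c + T} g"
    using c int by (subst add.commute, intro Henstock_Kurzweil_Integration.integral_combine) auto
  also have "\<dots> = integral {0..T} g"
    using integral_shift_interval[of 0 c T g] by (simp add: c_def shift_int add.commute)
  finally show ?thesis .
qed

lemma integral_periods: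
  fixes g :: "real \<Rightarrow> real"
  assumes period: "\<And>x. g (x + T) = g x" and T: "T > 0"
    and int: "\<And>a b. g integrable_on {a..b}"
  shows "integral {a..a + real m * T} g = real m * integral {0..T} g"
proof (induction m)
  case (Suc m)
  have "integral {a..a + real (Suc m) * T} g =
      integral {a..a + real m * T} g + integral {a + real m * T..a + real (Suc m) * T} g"
    using T int by (intro Henstock_Kurzweil_Integration.integral_combine[symmetric])
      (auto simp: algebra_simps)
  also have "integral {a + real m * T..a + real (Suc m) * T} g = integral {0..T} g"
    using integral_period[OF assms, of "a + real m * T"] by (simp add: algebra_simps)
  finally show ?case
    using Suc.IH by (simp add: algebra_simps)
qed simp

lemma set_integrable_bounded_Icc:
  fixes g :: "real \<Rightarrow> real"
  assumes "g \<in> borel_measurable borel" "\<And>u. \<bar>g u\<bar> \<le> B"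
  shows "set_integrable lborel {a..b} g"
  unfolding set_integrable_def
  using assms by (intro integrableI_bounded_set_indicator[where B = B])
    (auto simp: emeasure_lborel_Icc_eq)

lemma uniform_measure_Icc_density:
  assumes "a < b"
  shows "uniform_measure lborel {a..b} =
    density lborel (\<lambda>x. ennreal (indicator {a..b} x / (b - a)))"
proof -
  have "1 / ennreal (b - a) = ennreal (1 / (b - a))"
    using divide_ennreal[of 1 "b - a"] assms by simp
  then show ?thesis
    unfolding uniform_measure_def using assms
    by (intro density_cong) (auto simp: indicator_def)
qed

text \<open>The substitution \<open>u = b - m * s\<close> turns one period of \<open>s\<close> into
  \<open>m\<close> full periods of \<open>u\<close>, and the Jacobian \<open>1 / m\<close>
  compensates. So the expectation is the mean of \<open>g\<close> over a period, whatever
  \<open>b\<close> and \<open>m\<close> are.\<close>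

lemma (in prob_space) expectation_uniform_phase:
  fixes g :: "real \<Rightarrow> real"
  assumes X: "X \<in> borel_measurable M"
    and distr: "distr M borel X = uniform_measure lborel {0..2 * pi}"
    and g: "g \<in> borel_measurable borel" "\<And>u. \<bar>g u\<bar> \<le> B"
    and period: "\<And>u. g (u + 2 * pi) = g u"
    and m: "m \<ge> 1"
  shows "expectation (\<lambda>\<omega>. g (b - real m * X \<omega>)) = integral {0..2 * pi} g / (2 * pi)"
proof -
  note [measurable] = X g(1)
  let ?I = "{b - real m * (2 * pi)..b}"
  have int: "g integrable_on {c..d}" for c d
    using set_borel_integral_eq_integral(1)[OF set_integrable_bounded_Icc[OF g]] .
  have "expectation (\<lambda>\<omega>. g (b - real m * X \<omega>)) =
      integral\<^sup>L (distr M borel X) (\<lambda>s. g (b - real m * s))"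
    by (intro integral_distr[symmetric]) auto
  also have "\<dots> = (LINT s|lborel. (indicator {0..2 * pi} s / (2 * pi)) *\<^sub>R g (b - real m * s))"
    unfolding distr by (subst uniform_measure_Icc_density) (simp_all add: integral_density)
  also have "\<dots> = (LINT s|lborel. indicator ?I (b + (- real m) * s) * g (b + (- real m) * s)) / (2 * pi)"
  proof -
    have "indicator ?I (b + (- real m) * s) = (indicator {0..2 * pi} s :: real)" for s
      using m by (auto simp: indicator_def zero_le_mult_iff)
    then show ?thesis by simp
  qed
  also have "\<dots> = (LINT u|lborel. indicator ?I u * g u) / real m / (2 * pi)"
    using lborel_integral_real_affine[of "- real m" "\<lambda>u. indicator ?I u * g u" b] m by simp
  also have "(LINT u|lborel. indicator ?I u * g u) = integral ?I g"
    using set_borel_integral_eq_integral(2)[OF set_integrable_bounded_Icc[OF g]]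
    unfolding set_lebesgue_integral_def by simp
  also have "\<dots> = real m * integral {0..2 * pi} g"
    using integral_periods[OF period _ int, of "b - real m * (2 * pi)" m] by simp
  finally show ?thesis
    using m by simp
qed

text \<open>The square wave is 1 on the first half period and -1 on the second, up to endpoints;
  each half contributes \<open>2 * cos c\<close>.\<close>

lemma integral_sgn_sin_mult_sin:
  "integral {0..2 * pi} (\<lambda>u. sgn (sin u) * sin (u + c)) = 4 * cos c"
proof -
  let ?g = "\<lambda>u. sgn (sin u) * sin (u + c)"
  have F: "((\<lambda>u. e * sin (u + c)) has_integral e * (cos (a + c) - cos (b + c))) {a..b}"
    if "a \<le> b" for a b e :: real
  proof -
    have "((\<lambda>u. e * sin (u + c)) has_integral (- e * cos (b + c)) - (- e * cos (a + c))) {a..b}"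
      using that by (intro fundamental_theorem_of_calculus)
        (auto intro!: derivative_eq_intros
          simp: has_real_derivative_iff_has_vector_derivative[symmetric])
    then show ?thesis by (simp add: algebra_simps)
  qed
  have "(?g has_integral 1 * (cos (0 + c) - cos (pi + c))) {0..pi}"
    by (rule has_integral_spike_finite[of "{0, pi}", OF _ _ F]) (auto simp: sin_gt_zero)
  moreover have "(?g has_integral (-1) * (cos (pi + c) - cos (2 * pi + c))) {pi..2 * pi}"
    by (rule has_integral_spike_finite[of "{pi, 2 * pi}", OF _ _ F]) (auto simp: sin_lt_zero)
  ultimately have "(?g has_integral 1 * (cos (0 + c) - cos (pi + c)) +
      (-1) * (cos (pi + c) - cos (2 * pi + c))) {0..2 * pi}"
    by (intro has_integral_combine[of 0 pi "2 * pi"]) auto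
  then show ?thesis
    by (simp add: integral_unique cos_add)
qed

text \<open>Taylor's formula gives \<open>sin u \<ge> u - u ^ 3 / 6\<close>, and
  \<open>u \<le> 1.6\<close> yields \<open>u * u \<le> 3\<close>, so the cubic term takes away at
  most \<open>u / 2\<close>.\<close>

lemma sin_ge_half:
  fixes u :: real
  assumes "0 \<le> u" "u \<le> pi / 2"
  shows "u / 2 \<le> sin u"
proof -
  have "\<bar>sin u - (\<Sum>m<3. sin_coeff m * u ^ m)\<bar> \<le> inverse (fact 3) * \<bar>u\<bar> ^ 3"
    by (rule Maclaurin_sin_bound)
  then have "\<bar>sin u - u\<bar> \<le> u ^ 3 / 6"
    using assms by (simp add: numeral_3_eq_3 sin_coeff_def field_simps)
  then have "u - u ^ 3 / 6 \<le> sin u"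
    by (simp only: abs_le_iff) linarith
  moreover have "u \<le> 1.6"
    using assms pi_less_4 pi_approx by simp
  then have "u * u \<le> 1.6 * 1.6"
    using assms by (intro mult_mono) auto
  then have "u * (u * u) \<le> u * 3"
    using assms by (intro mult_left_mono) auto
  ultimately show ?thesis
    by (simp add: power3_eq_cube)
qed

text \<open>By \<open>sin_ge_half\<close> and symmetry, a small sine forces \<open>u\<close> to lie
  within \<open>2 * t\<close> of 0, \<open>pi\<close> or \<open>2 * pi\<close>. Inside the period
  these neighbourhoods have lengths \<open>2 * t\<close>, \<open>4 * t\<close> and
  \<open>2 * t\<close>.\<close>

lemma integral_indicator_abs_sin_le:
  assumes t: "0 \<le> t"
  shows "integral {0..2 * pi} (indicator {u. \<bar>sin u\<bar> \<le> t}) \<le> 8 * t"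
proof -
  let ?S = "{u::real. \<bar>sin u\<bar> \<le> t}"
  have "closed ?S"
    by (intro closed_Collect_le continuous_intros)
  then have S: "{0..2 * pi} \<inter> ?S \<in> lmeasurable"
    by (intro lmeasurable_compact compact_Int_closed) auto
  have sub: "{0..2 * pi} \<inter> ?S \<subseteq> {0..2 * t} \<union> {pi - 2 * t..pi + 2 * t} \<union> {2 * pi - 2 * t..2 * pi}"
  proof
    fix u assume "u \<in> {0..2 * pi} \<inter> ?S"
    then have u: "0 \<le> u" "u \<le> 2 * pi" "sin u \<le> t" "- sin u \<le> t"
      by (auto simp: abs_le_iff)
    consider "u \<le> pi / 2" | "pi / 2 \<le> u" "u \<le> pi" | "pi \<le> u" "u \<le> 3 / 2 * pi" | "3 / 2 * pi \<le> u"
      by linarith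
    then show "u \<in> {0..2 * t} \<union> {pi - 2 * t..pi + 2 * t} \<union> {2 * pi - 2 * t..2 * pi}"
    proof cases
      case 1
      then have "u / 2 \<le> t"
        using sin_ge_half[of u] u by linarith
      then show ?thesis using u by auto
    next
      case 2
      then have "(pi - u) / 2 \<le> sin u"
        using sin_ge_half[of "pi - u"] by (simp add: sin_diff)
      then have "(pi - u) / 2 \<le> t"
        using u(3) by (rule order_trans)
      then show ?thesis using 2 t by (auto simp: field_simps)
    next
      case 3
      then have "(u - pi) / 2 \<le> - sin u"
        using sin_ge_half[of "u - pi"] by (simp add: sin_diff)
      then have "(u - pi) / 2 \<le> t"
        using u(4) by (rule order_trans)
      then show ?thesis using 3 t by (auto simp: field_simps)
    next
      case 4
      then have "(2 * pi - u) / 2 \<le> - sin u"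
        using sin_ge_half[of "2 * pi - u"] u by (simp add: sin_diff)
      then have "(2 * pi - u) / 2 \<le> t"
        using u(4) by (rule order_trans)
      then show ?thesis using u by (auto simp: field_simps)
    qed
  qed
  have "integral {0..2 * pi} (indicator ?S) = measure lebesgue ({0..2 * pi} \<inter> ?S)"
    using S by (simp add: integral_indicator Int_commute)
  also have "\<dots> \<le> measure lebesgue
      ({0..2 * t} \<union> {pi - 2 * t..pi + 2 * t} \<union> {2 * pi - 2 * t..2 * pi})"
    using S by (intro measure_mono_fmeasurable[OF sub]) auto
  also have "\<dots> \<le> measure lebesgue {0..2 * t} + measure lebesgue {pi - 2 * t..pi + 2 * t} +
      measure lebesgue {2 * pi - 2 * t..2 * pi}"
    by (intro order_trans[OF measure_Un_le] add_mono order_refl) auto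
  also have "\<dots> = 8 * t"
    using t by simp
  finally show ?thesis .
qed

section \<open>Uniform concentration over pairs of points\<close>

text \<open>Each variable ranges over an interval of length 2, so the squared lengths add up to
  \<open>4 * N\<close> in Hoeffding's exponent.\<close>

lemma (in prob_space) hoeffding_abs_le_one:
  fixes Y :: "nat \<Rightarrow> 'a \<Rightarrow> real"
  assumes indep: "indep_vars (\<lambda>_. borel) Y {1..N}"
    and bound: "\<And>m \<omega>. \<bar>Y m \<omega>\<bar> \<le> 1" and N: "N \<ge> 1" and \<epsilon>: "\<epsilon> \<ge> 0"
  shows "prob {\<omega>\<in>space M. \<bar>(\<Sum>m=1..N. Y m \<omega>) - (\<Sum>m=1..N. expectation (Y m))\<bar> \<ge> \<epsilon>}
    \<le> 2 * exp (- \<epsilon>\<^sup>2 / (2 * real N))"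
proof -
  interpret Hoeffding_ineq M "{1..N}" Y "\<lambda>_. -1" "\<lambda>_. 1" "\<Sum>m=1..N. expectation (Y m)"
  proof unfold_locales
    fix m
    have "-1 \<le> Y m \<omega>" "Y m \<omega> \<le> 1" for \<omega>
      using bound[of m \<omega>] by linarith+
    then show "AE \<omega> in M. Y m \<omega> \<in> {-1..1}"
      by simp
  qed (use indep in simp_all)
  show ?thesis
    using Hoeffding_ineq_abs_ge[OF \<epsilon>] N by (simp add: field_simps)
qed

text \<open>With deviation \<open>4 * sqrt (N * ln N)\<close> Hoeffding's bound is
  \<open>2 / N ^ 8\<close>. A union over \<open>K * N ^ 6\<close> indices, the order of the number
  of pairs from a grid of mesh \<open>N ^ -3\<close>, leaves the summable
  \<open>2 * K / N ^ 2\<close>. Functions and index sets may change with \<open>N\<close>, as the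
  grid does.\<close>

lemma (in prob_space) hoeffding_borel_cantelli:
  fixes X :: "nat \<Rightarrow> 'a \<Rightarrow> real" and f :: "nat \<Rightarrow> 'i \<Rightarrow> nat \<Rightarrow> real \<Rightarrow> real"
  assumes indep: "indep_vars (\<lambda>_. borel) X {1..}"
    and meas: "\<And>N i m. f N i m \<in> borel_measurable borel"
    and bound: "\<And>N i m s. \<bar>f N i m s\<bar> \<le> 1"
    and fin: "\<And>N. finite (I N)"
    and card: "\<And>N. N \<ge> 1 \<Longrightarrow> real (card (I N)) \<le> K * real N ^ 6"
  shows "AE \<omega> in M. \<forall>\<^sub>F N in sequentially. \<forall>i\<in>I N.
    \<bar>(\<Sum>m=1..N. f N i m (X m \<omega>)) - (\<Sum>m=1..N. expectation (\<lambda>\<omega>. f N i m (X m \<omega>)))\<bar>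
      \<le> 4 * sqrt (real N * ln (real N))"
proof -
  define \<epsilon> where "\<epsilon> N = 4 * sqrt (real N * ln (real N))" for N :: nat
  define E where "E N i = {\<omega>\<in>space M. \<bar>(\<Sum>m=1..N. f N i m (X m \<omega>)) -
    (\<Sum>m=1..N. expectation (\<lambda>\<omega>. f N i m (X m \<omega>)))\<bar> \<ge> \<epsilon> N}" for N i
  define A where "A N = (\<Union>i\<in>I N. E N i)" for N
  have X [measurable]: "X m \<in> borel_measurable M" if "m \<ge> 1" for m
    using indep that unfolding indep_vars_def by auto
  have [measurable]: "E N i \<in> sets M" for N i
  proof -
    have [measurable]: "(\<lambda>\<omega>. \<Sum>m=1..N. f N i m (X m \<omega>)) \<in> borel_measurable M"
      by (intro borel_measurable_sum measurable_compose[OF X meas]) auto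
    show ?thesis
      unfolding E_def by measurable
  qed
  have A [measurable]: "A N \<in> sets M" for N
    unfolding A_def using fin by (intro sets.finite_UN) auto
  have E_le: "prob (E N i) \<le> 2 / real N ^ 8" if N: "N \<ge> 1" for N i
  proof -
    have "indep_vars (\<lambda>_. borel) (\<lambda>m \<omega>. f N i m (X m \<omega>)) {1..N}"
      using indep_vars_compose2[OF indep_vars_subset[OF indep], of "{1..N}" "f N i" "\<lambda>_. borel"]
        meas by auto
    then have "prob (E N i) \<le> 2 * exp (- (\<epsilon> N)\<^sup>2 / (2 * real N))"
      unfolding E_def using bound N
      by (intro hoeffding_abs_le_one) (auto simp: \<epsilon>_def)
    also have "(\<epsilon> N)\<^sup>2 = 16 * (real N * ln (real N))"
      using N by (simp add: \<epsilon>_def power_mult_distrib)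
    also have "- (16 * (real N * ln (real N))) / (2 * real N) = - (8 * ln (real N))"
      using N by (simp add: field_simps)
    also have "exp (- (8 * ln (real N))) = 1 / real N ^ 8"
      using N exp_of_nat_mult[of 8 "ln (real N)"] by (simp add: exp_minus inverse_eq_divide)
    finally show ?thesis by simp
  qed
  have A_le: "prob (A N) \<le> 2 * K * inverse (real N ^ 2)" if N: "N \<ge> 1" for N
  proof -
    have "prob (A N) \<le> (\<Sum>i\<in>I N. prob (E N i))"
      unfolding A_def using fin by (intro finite_measure_subadditive_finite) auto
    also have "\<dots> \<le> (\<Sum>i\<in>I N. 2 / real N ^ 8)"
      using E_le[OF N] by (intro sum_mono)
    also have "\<dots> \<le> K * real N ^ 6 * (2 / real N ^ 8)"
      unfolding sum_constant using card[OF N] by (intro mult_right_mono) auto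
    also have "\<dots> = 2 * K * inverse (real N ^ 2)"
      using N by (simp add: field_simps flip: power_add)
    finally show ?thesis .
  qed
  have "summable (\<lambda>N. prob (A N))"
  proof (rule summable_comparison_test_ev)
    show "\<forall>\<^sub>F N in sequentially. norm (prob (A N)) \<le> 2 * K * inverse (real N ^ 2)"
      using eventually_ge_at_top[of 1] by eventually_elim (use A_le in auto)
    show "summable (\<lambda>N. 2 * K * inverse (real N ^ 2))"
      by (intro summable_mult inverse_power_summable) auto
  qed
  then have "AE \<omega> in M. \<forall>\<^sub>F N in sequentially. \<omega> \<in> space M - A N"
    by (intro borel_cantelli_AE1) (auto simp: less_top[symmetric])
  then show ?thesis
  proof eventually_elim
    case (elim \<omega>)
    then show ?case
      by eventually_elim (auto simp: A_def E_def \<epsilon>_def not_le intro: less_imp_le)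
  qed
qed

section \<open>Trigonometric estimates and phase sums\<close>

lemma abs_sin_diff_le: "\<bar>sin a - sin b\<bar> \<le> \<bar>a - b\<bar>" for a b :: real
proof -
  have "\<bar>sin a - sin b\<bar> = 2 * \<bar>sin ((a - b) / 2)\<bar> * \<bar>cos ((a + b) / 2)\<bar>"
    by (simp add: sin_diff_sin abs_mult)
  also have "\<dots> \<le> 2 * \<bar>(a - b) / 2\<bar> * 1"
    using abs_sin_x_le_abs_x[of "(a - b) / 2"] by (intro mult_mono) auto
  finally show ?thesis by simp
qed

lemma abs_cos_diff_le: "\<bar>cos a - cos b\<bar> \<le> \<bar>a - b\<bar>" for a b :: real
  using abs_sin_diff_le[of "pi / 2 - a" "pi / 2 - b"] by (simp add: sin_diff)

text \<open>This is the Dirichlet kernel bound: multiplied by \<open>2 * sin (\<delta> / 2)\<close>,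
  the sum telescopes to a difference of two sines.\<close>

lemma abs_sum_cos_le:
  fixes \<delta> :: real
  assumes "sin (\<delta> / 2) \<noteq> 0"
  shows "\<bar>\<Sum>m=1..N. cos (real m * \<delta>)\<bar> \<le> 1 / \<bar>sin (\<delta> / 2)\<bar>"
proof -
  have "2 * sin (\<delta> / 2) * (\<Sum>m=1..N. cos (real m * \<delta>)) =
      sin (real N * \<delta> + \<delta> / 2) - sin (\<delta> / 2)"
  proof (induction N)
    case (Suc N)
    have "2 * sin (\<delta> / 2) * cos (real (Suc N) * \<delta>) =
        sin (real (Suc N) * \<delta> + \<delta> / 2) - sin (real (Suc N) * \<delta> - \<delta> / 2)"
      by (simp add: sin_add sin_diff)
    also have "real (Suc N) * \<delta> - \<delta> / 2 = real N * \<delta> + \<delta> / 2"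
      by (simp add: field_simps)
    finally show ?case
      using Suc.IH by (simp add: distrib_left)
  qed simp
  then have "2 * \<bar>sin (\<delta> / 2)\<bar> * \<bar>\<Sum>m=1..N. cos (real m * \<delta>)\<bar> =
      \<bar>sin (real N * \<delta> + \<delta> / 2) - sin (\<delta> / 2)\<bar>"
    by (metis abs_mult abs_numeral)
  also have "\<dots> \<le> 2"
    using abs_sin_le_one[of "real N * \<delta> + \<delta> / 2"] abs_sin_le_one[of "\<delta> / 2"] by linarith
  finally show ?thesis
    using assms by (simp add: field_simps)
qed

text \<open>The offset \<open>b\<close> treats both families at once: \<open>b = 0\<close> gives the
  sines of the shifted basis and \<open>b = pi / 2\<close> the cosines.\<close>

definition phase_sum :: "(nat \<Rightarrow> real) \<Rightarrow> real \<Rightarrow> nat \<Rightarrow> real \<Rightarrow> real \<Rightarrow> real" where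
  "phase_sum s b N x y =
    (\<Sum>m=1..N. sgn (sin (real m * x + b - real m * s m)) * sin (real m * y + b - real m * s m))"

lemma sum_real_le_square: "(\<Sum>m=1..N. real m) \<le> real N ^ 2"
proof -
  have "(\<Sum>m=1..N. real m) \<le> (\<Sum>m=1..N. real N)"
    by (intro sum_mono) auto
  then show ?thesis by (simp add: power2_eq_square)
qed

text \<open>The change splits into a change of the value, at most \<open>t\<close>, and a change of
  the sign, at most 2. Signs differ only if 0 lies between \<open>p\<close> and \<open>p'\<close>,
  which puts \<open>p'\<close> within \<open>t\<close> of 0.\<close>

lemma sgn_mult_diff_le:
  fixes p q p' q' t :: real
  assumes p: "\<bar>p - p'\<bar> \<le> t" and q: "\<bar>q - q'\<bar> \<le> t" and q': "\<bar>q'\<bar> \<le> 1"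
  shows "\<bar>sgn p * q - sgn p' * q'\<bar> \<le> t + (if \<bar>p'\<bar> \<le> t then 2 else 0)"
proof -
  have "sgn p * q - sgn p' * q' = sgn p * (q - q') + (sgn p - sgn p') * q'"
    by (simp add: algebra_simps)
  also have "\<bar>\<dots>\<bar> \<le> \<bar>sgn p\<bar> * \<bar>q - q'\<bar> + \<bar>sgn p - sgn p'\<bar> * \<bar>q'\<bar>"
    by (rule order_trans[OF abs_triangle_ineq]) (simp add: abs_mult)
  also have "\<dots> \<le> 1 * t + (if \<bar>p'\<bar> \<le> t then 2 else 0) * 1"
  proof (rule add_mono)
    show "\<bar>sgn p\<bar> * \<bar>q - q'\<bar> \<le> 1 * t"
      using q by (intro mult_mono) (auto simp: abs_sgn_eq)
    have "\<bar>sgn p - sgn p'\<bar> \<le> (if \<bar>p'\<bar> \<le> t then 2 else 0)"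
      using p by (cases p "0::real" rule: linorder_cases; cases p' "0::real" rule: linorder_cases)
        auto
    then show "\<bar>sgn p - sgn p'\<bar> * \<bar>q'\<bar> \<le> (if \<bar>p'\<bar> \<le> t then 2 else 0) * 1"
      using q' by (rule mult_mono) auto
  qed
  finally show ?thesis by simp
qed

text \<open>A sign differs between \<open>x\<close> and \<open>x'\<close> only if the wave is small at \<open>x'\<close>.\<close>

lemma phase_sum_perturb:
  assumes N: "N \<ge> 1" and x: "\<bar>x - x'\<bar> \<le> 1 / real N ^ 3" and y: "\<bar>y - y'\<bar> \<le> 1 / real N ^ 3"
  shows "\<bar>phase_sum s b N x y - phase_sum s b N x' y'\<bar> \<le> 1 +
    2 * (\<Sum>m=1..N. indicator {u. \<bar>sin u\<bar> \<le> 1 / real N ^ 2} (real m * x' + b - real m * s m))"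
proof -
  let ?J = "\<lambda>m. indicator {u. \<bar>sin u\<bar> \<le> 1 / real N ^ 2} (real m * x' + b - real m * s m) :: real"
  \<comment> \<open>The mesh \<open>N ^ -3\<close> is chosen so that, even multiplied by a frequency
    up to \<open>N\<close>, it moves the phase by at most \<open>N ^ -2\<close>; over
    \<open>N\<close> terms this totals at most 1.\<close>
  have small: "real m * \<bar>z\<bar> \<le> 1 / real N ^ 2" if "m \<le> N" "\<bar>z\<bar> \<le> 1 / real N ^ 3" for m z
  proof -
    have "real m * \<bar>z\<bar> \<le> real N * (1 / real N ^ 3)"
      using that by (intro mult_mono) auto
    also have "\<dots> = 1 / real N ^ 2"
      using N by (simp add: power2_eq_square power3_eq_cube)
    finally show ?thesis .
  qed
  have term_le: "\<bar>sgn (sin (real m * x + b - real m * s m)) * sin (real m * y + b - real m * s m) -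
      sgn (sin (real m * x' + b - real m * s m)) * sin (real m * y' + b - real m * s m)\<bar>
      \<le> 1 / real N ^ 2 + 2 * ?J m" (is "\<bar>sgn ?p * ?q - sgn ?p' * ?q'\<bar> \<le> _") if m: "m \<le> N" for m
  proof -
    have "\<bar>?p - ?p'\<bar> \<le> real m * \<bar>x - x'\<bar>"
      using abs_sin_diff_le[of "real m * x + b - real m * s m" "real m * x' + b - real m * s m"]
      by (simp add: abs_mult flip: right_diff_distrib)
    then have p: "\<bar>?p - ?p'\<bar> \<le> 1 / real N ^ 2"
      using small[OF m x] by simp
    have "\<bar>?q - ?q'\<bar> \<le> real m * \<bar>y - y'\<bar>"
      using abs_sin_diff_le[of "real m * y + b - real m * s m" "real m * y' + b - real m * s m"]
      by (simp add: abs_mult flip: right_diff_distrib)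
    then have q: "\<bar>?q - ?q'\<bar> \<le> 1 / real N ^ 2"
      using small[OF m y] by simp
    have "(if \<bar>?p'\<bar> \<le> 1 / real N ^ 2 then 2 else 0) = 2 * ?J m"
      by (simp add: indicator_def)
    then show ?thesis
      using sgn_mult_diff_le[OF p q abs_sin_le_one] by (simp only:)
  qed
  have "\<bar>phase_sum s b N x y - phase_sum s b N x' y'\<bar> \<le> (\<Sum>m=1..N. 1 / real N ^ 2 + 2 * ?J m)"
    unfolding phase_sum_def sum_subtractf[symmetric]
    by (intro order_trans[OF sum_abs] sum_mono term_le) auto
  also have "\<dots> = real N * (1 / real N ^ 2) + 2 * (\<Sum>m=1..N. ?J m)"
    by (simp add: sum.distrib sum_distrib_left)
  also have "real N * (1 / real N ^ 2) \<le> 1"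
    using N by (simp add: power2_eq_square)
  finally show ?thesis by simp
qed

text \<open>In the half-open representation distinct points differ by less than a full turn, so the
  half difference has absolute value strictly between 0 and \<open>pi\<close>.\<close>

lemma sin_half_diff_circle:
  assumes "x \<in> circle" "y \<in> circle" "x \<noteq> y"
  shows "sin ((y - x) / 2) \<noteq> 0"
proof -
  have "0 < \<bar>(y - x) / 2\<bar>" "\<bar>(y - x) / 2\<bar> < pi"
    using assms by (auto simp: circle_def)
  then have "sin \<bar>(y - x) / 2\<bar> > 0"
    by (rule sin_gt_zero)
  then show ?thesis
    by (auto simp: abs_if split: if_splits)
qed

text \<open>Neither the null set nor the threshold for \<open>N\<close> depends on \<open>x\<close>
  and \<open>y\<close>: randomness is controlled on finite grids, and the passage to all points is
  deterministic. With \<open>\<epsilon> = 4 * sqrt (N * ln N)\<close>, moving to the grid costs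
  \<open>5 + 2 * \<epsilon>\<close>, deviating from the mean costs \<open>\<epsilon>\<close>, and
  the mean is at most 2 plus the kernel bound.\<close>

lemma (in prob_space) phase_sum_bound:
  fixes X :: "nat \<Rightarrow> 'a \<Rightarrow> real"
  assumes indep: "indep_vars (\<lambda>_. borel) X {1..}"
    and distr: "\<And>k. k \<ge> 1 \<Longrightarrow> distr M borel (X k) = uniform_measure lborel {0..2 * pi}"
  shows "AE \<omega> in M. \<forall>\<^sub>F N in sequentially. \<forall>x\<in>circle. \<forall>y\<in>circle. x \<noteq> y \<longrightarrow>
    \<bar>phase_sum (\<lambda>k. X k \<omega>) b N x y\<bar>
      \<le> 7 + 12 * sqrt (real N * ln (real N)) + 1 / \<bar>sin ((y - x) / 2)\<bar>"
proof -
  have X: "X m \<in> borel_measurable M" if "m \<ge> 1" for m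
    using indep that unfolding indep_vars_def by auto
  define p where "p N i = real i / real N ^ 3" for N i :: nat
  \<comment> \<open>\<open>Z\<close> is the term of frequency \<open>m\<close> at a pair of grid
    points; \<open>W\<close> marks a frequency whose wave is so close to zero at a grid point that a
    sign may flip nearby.\<close>
  define Z where "Z N ij m s = sgn (sin (real m * p N (fst ij) + b - real m * s)) *
    sin (real m * p N (snd ij) + b - real m * s)" for N ij m s
  define W where "W N i m s = (indicator {u. \<bar>sin u\<bar> \<le> 1 / real N ^ 2}
    (real m * p N i + b - real m * s) :: real)" for N i m s
  have Z_exp: "expectation (\<lambda>\<omega>. Z N ij m (X m \<omega>)) =
      2 / pi * cos (real m * (p N (snd ij) - p N (fst ij)))" if m: "m \<ge> 1" for N ij m
  proof -
    let ?c = "real m * (p N (snd ij) - p N (fst ij))"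
    let ?g = "\<lambda>u. sgn (sin u) * sin (u + ?c)"
    have "expectation (\<lambda>\<omega>. ?g (real m * p N (fst ij) + b - real m * X m \<omega>)) =
        integral {0..2 * pi} ?g / (2 * pi)"
    proof (rule expectation_uniform_phase[OF X[OF m] distr[OF m] _ _ _ m])
      show "\<bar>?g u\<bar> \<le> 1" for u
        by (auto simp: abs_mult sgn_real_def)
      show "?g (u + 2 * pi) = ?g u" for u
        using sin_periodic[of "u + ?c"] by (simp add: add_ac)
    qed measurable
    also have "\<dots> = 2 / pi * cos ?c"
      unfolding integral_sgn_sin_mult_sin by simp
    finally show ?thesis
      by (simp add: Z_def algebra_simps)
  qed
  have W_exp: "expectation (\<lambda>\<omega>. W N i m (X m \<omega>)) \<le> 2 / real N ^ 2" if m: "m \<ge> 1" for N i m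
  proof -
    let ?g = "indicator {u::real. \<bar>sin u\<bar> \<le> 1 / real N ^ 2} :: real \<Rightarrow> real"
    have "expectation (\<lambda>\<omega>. ?g (real m * p N i + b - real m * X m \<omega>)) =
        integral {0..2 * pi} ?g / (2 * pi)"
    proof (rule expectation_uniform_phase[OF X[OF m] distr[OF m] _ _ _ m])
      show "\<bar>?g u\<bar> \<le> 1" for u
        by (auto simp: indicator_def)
      show "?g (u + 2 * pi) = ?g u" for u
        by (simp add: indicator_def)
    qed measurable
    also have "\<dots> \<le> 8 * (1 / real N ^ 2) / (2 * pi)"
      using integral_indicator_abs_sin_le[of "1 / real N ^ 2"] by (intro divide_right_mono) auto
    also have "\<dots> \<le> 8 * (1 / real N ^ 2) / 4"
      using pi_ge_two by (intro divide_left_mono) auto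
    finally show ?thesis
      by (simp add: W_def)
  qed
  \<comment> \<open>Since \<open>2 * pi < 7\<close>, grid indices up to \<open>7 * N ^ 3\<close>
    cover the circle.\<close>
  have card_le: "real (7 * N ^ 3 + 1) \<le> 8 * real N ^ 3" if "N \<ge> 1" for N
    using one_le_power[of "real N" 3] that by simp
  have "AE \<omega> in M. \<forall>\<^sub>F N in sequentially. \<forall>ij\<in>{..7 * N ^ 3} \<times> {..7 * N ^ 3}.
      \<bar>(\<Sum>m=1..N. Z N ij m (X m \<omega>)) - (\<Sum>m=1..N. expectation (\<lambda>\<omega>. Z N ij m (X m \<omega>)))\<bar>
        \<le> 4 * sqrt (real N * ln (real N))"
  proof (rule hoeffding_borel_cantelli[OF indep])
    show "Z N ij m \<in> borel_measurable borel" for N ij m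
      unfolding Z_def by measurable
    show "\<bar>Z N ij m s\<bar> \<le> 1" for N ij m s
      by (auto simp: Z_def abs_mult sgn_real_def)
    fix N :: nat assume "N \<ge> 1"
    have "real (card ({..7 * N ^ 3} \<times> {..7 * N ^ 3})) = real (7 * N ^ 3 + 1) * real (7 * N ^ 3 + 1)"
      by (simp add: card_cartesian_product algebra_simps)
    also have "\<dots> \<le> (8 * real N ^ 3) * (8 * real N ^ 3)"
      using \<open>N \<ge> 1\<close> by (intro mult_mono card_le) auto
    also have "\<dots> = 64 * real N ^ 6"
      by (simp flip: power_add)
    finally show "real (card ({..7 * N ^ 3} \<times> {..7 * N ^ 3})) \<le> 64 * real N ^ 6" .
  qed simp
  moreover have "AE \<omega> in M. \<forall>\<^sub>F N in sequentially. \<forall>i\<in>{..7 * N ^ 3}.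
      \<bar>(\<Sum>m=1..N. W N i m (X m \<omega>)) - (\<Sum>m=1..N. expectation (\<lambda>\<omega>. W N i m (X m \<omega>)))\<bar>
        \<le> 4 * sqrt (real N * ln (real N))"
  proof (rule hoeffding_borel_cantelli[OF indep])
    show "W N i m \<in> borel_measurable borel" for N i m
      unfolding W_def by measurable
    show "\<bar>W N i m s\<bar> \<le> 1" for N i m s
      by (simp add: W_def indicator_def)
    fix N :: nat assume N: "N \<ge> 1"
    \<comment> \<open>Single grid points number only on the order of \<open>N ^ 3\<close>; the bound
      is relaxed to the form that covers pairs.\<close>
    then have "8 * real N ^ 3 \<le> 8 * real N ^ 6"
      by (intro mult_left_mono power_increasing) auto
    then show "real (card {..7 * N ^ 3}) \<le> 8 * real N ^ 6"
      using card_le[OF N] by simp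
  qed simp
  ultimately show ?thesis
  proof eventually_elim
    case (elim \<omega>)
    from elim eventually_ge_at_top[of 1] show ?case
    proof eventually_elim
      case (elim N)
      define \<epsilon> where "\<epsilon> = 4 * sqrt (real N * ln (real N))"
      note Z = elim(1)[folded \<epsilon>_def] and W = elim(2)[folded \<epsilon>_def] and N = elim(3)
      have N3: "real N ^ 3 > 0"
        using N by simp
      show ?case
      proof (intro ballI impI)
        fix x y assume xy: "x \<in> circle" "y \<in> circle" "x \<noteq> y"
        \<comment> \<open>The witness is \<open>z * N ^ 3\<close> rounded down.\<close>
        have grid: "\<exists>i\<le>7 * N ^ 3. \<bar>z - p N i\<bar> \<le> 1 / real N ^ 3" if "z \<in> circle" for z
        proof -
          have z: "0 \<le> z" "z < 7"
            using that pi_less_4 pi_approx by (auto simp: circle_def)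
          let ?i = "nat \<lfloor>z * real N ^ 3\<rfloor>"
          have "z * real N ^ 3 \<le> 7 * real N ^ 3"
            using z by (intro mult_right_mono) auto
          then have "\<lfloor>z * real N ^ 3\<rfloor> \<le> \<lfloor>real (7 * N ^ 3)\<rfloor>"
            by (intro floor_mono) simp
          then have i: "?i \<le> 7 * N ^ 3"
            by (metis floor_of_nat nat_int nat_mono)
          have "real ?i \<le> z * real N ^ 3" "z * real N ^ 3 \<le> real ?i + 1"
            using z by simp_all
          moreover have "\<bar>z - r / K\<bar> \<le> 1 / K" if "r \<le> z * K" "z * K \<le> r + 1" "K > 0" for r K
          proof -
            have "z - r / K = (z * K - r) / K"
              using that by (simp add: field_simps)
            moreover have "\<bar>z * K - r\<bar> \<le> 1"
              using that by linarith
            ultimately show ?thesis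
              using that by (simp add: divide_right_mono)
          qed
          ultimately have "\<bar>z - p N ?i\<bar> \<le> 1 / real N ^ 3"
            unfolding p_def using N3 by blast
          with i show ?thesis by blast
        qed
        obtain i where i: "i \<le> 7 * N ^ 3" "\<bar>x - p N i\<bar> \<le> 1 / real N ^ 3"
          using grid[OF xy(1)] by blast
        obtain j where j: "j \<le> 7 * N ^ 3" "\<bar>y - p N j\<bar> \<le> 1 / real N ^ 3"
          using grid[OF xy(2)] by blast
        define s where "s = (\<lambda>k. X k \<omega>)"
        have "(\<Sum>m=1..N. expectation (\<lambda>\<omega>. W N i m (X m \<omega>))) \<le> (\<Sum>m=1..N. 2 / real N ^ 2)"
          by (intro sum_mono W_exp) auto
        also have "\<dots> \<le> 2"
          using N by (simp add: power2_eq_square field_simps)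
        \<comment> \<open>At most \<open>2 + \<epsilon>\<close> frequencies are at risk: the
          expected number is at most 2, the deviation at most \<open>\<epsilon>\<close>. Each costs
          2 in the perturbation bound, whence \<open>1 + 2 * (2 + \<epsilon>)\<close>.\<close>
        finally have "(\<Sum>m=1..N. W N i m (X m \<omega>)) \<le> 2 + \<epsilon>"
          using W i(1) by (force simp: abs_le_iff)
        then have perturb: "\<bar>phase_sum s b N x y - phase_sum s b N (p N i) (p N j)\<bar> \<le> 5 + 2 * \<epsilon>"
          using phase_sum_perturb[OF N i(2) j(2), of s b] by (simp add: W_def s_def)
        have "\<bar>phase_sum s b N (p N i) (p N j) -
            (\<Sum>m=1..N. 2 / pi * cos (real m * (p N j - p N i)))\<bar> \<le> \<epsilon>"
          using bspec[OF Z, of "(i, j)"] i(1) j(1) Z_exp[of _ N "(i, j)"]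
          by (simp add: phase_sum_def Z_def s_def)
        then have deviation: "\<bar>phase_sum s b N (p N i) (p N j)\<bar> \<le>
            \<epsilon> + \<bar>2 / pi * (\<Sum>m=1..N. cos (real m * (p N j - p N i)))\<bar>"
          unfolding sum_distrib_left by linarith
        \<comment> \<open>The kernel bound must involve \<open>y - x\<close>, not the grid
          difference, which can vanish for nearby points. The exchange costs
          \<open>2 * m / N ^ 3\<close> per term, at most 2 in total.\<close>
        have "\<bar>(\<Sum>m=1..N. cos (real m * (p N j - p N i))) - (\<Sum>m=1..N. cos (real m * (y - x)))\<bar>
            \<le> (\<Sum>m=1..N. 2 / real N ^ 3 * real m)"
          unfolding sum_subtractf[symmetric]
        proof (intro order_trans[OF sum_abs] sum_mono)
          fix m :: nat
          have "\<bar>cos (real m * (p N j - p N i)) - cos (real m * (y - x))\<bar> \<le>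
              real m * \<bar>(p N j - p N i) - (y - x)\<bar>"
            using abs_cos_diff_le[of "real m * (p N j - p N i)" "real m * (y - x)"]
            by (simp add: abs_mult flip: right_diff_distrib)
          also have "\<dots> \<le> real m * (2 / real N ^ 3)"
            using i(2) j(2) by (intro mult_left_mono) (simp_all add: field_simps abs_if split: if_splits)
          finally show "\<bar>cos (real m * (p N j - p N i)) - cos (real m * (y - x))\<bar> \<le>
              2 / real N ^ 3 * real m"
            by (simp add: mult.commute)
        qed
        also have "\<dots> \<le> 2 / real N ^ 3 * real N ^ 2"
          unfolding sum_distrib_left[symmetric] by (intro mult_left_mono sum_real_le_square) auto
        also have "\<dots> \<le> 2"
          using N by (simp add: field_simps power2_eq_square power3_eq_cube)
        finally have "\<bar>\<Sum>m=1..N. cos (real m * (p N j - p N i))\<bar> \<le> 2 + 1 / \<bar>sin ((y - x) / 2)\<bar>"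
          using abs_sum_cos_le[OF sin_half_diff_circle[OF xy], of N] by linarith
        moreover have "\<bar>2 / pi * S\<bar> \<le> \<bar>S\<bar>" for S :: real
        proof -
          have "\<bar>2 / pi\<bar> * \<bar>S\<bar> \<le> 1 * \<bar>S\<bar>"
            using pi_ge_two by (intro mult_right_mono) auto
          then show ?thesis
            by (simp add: abs_mult)
        qed
        ultimately have "\<bar>2 / pi * (\<Sum>m=1..N. cos (real m * (p N j - p N i)))\<bar> \<le>
            2 + 1 / \<bar>sin ((y - x) / 2)\<bar>"
          using order_trans by blast
        then have "\<bar>phase_sum s b N x y\<bar> \<le> 7 + 3 * \<epsilon> + 1 / \<bar>sin ((y - x) / 2)\<bar>"
          using perturb deviation by linarith
        then show "\<bar>phase_sum (\<lambda>k. X k \<omega>) b N x y\<bar> \<le>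
            7 + 12 * sqrt (real N * ln (real N)) + 1 / \<bar>sin ((y - x) / 2)\<bar>"
          by (simp add: s_def \<epsilon>_def)
      qed
    qed
  qed
qed

section \<open>From phase sums to the random basis\<close>

lemma amalg_shifted_even:
  "amalg (shifted_circle_basis s) (2 * N) x y = phase_sum s 0 N x y + phase_sum s (pi / 2) N x y"
proof (induction N)
  case 0
  then show ?case by (simp add: amalg_def phase_sum_def)
next
  case (Suc N)
  let ?t = "\<lambda>k. sgn (shifted_circle_basis s k x) * shifted_circle_basis s k y"
  let ?u = "\<lambda>b. sgn (sin (real (Suc N) * x + b - real (Suc N) * s (Suc N))) *
    sin (real (Suc N) * y + b - real (Suc N) * s (Suc N))"
  have "?t (2 * N + 1) = ?u 0"
    by (simp add: shifted_circle_basis_def Let_def algebra_simps)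
  moreover have "sin (real (Suc N) * z + pi / 2 - real (Suc N) * s (Suc N)) =
      cos (real (Suc N) * (z - s (Suc N)))" for z
  proof -
    have "real (Suc N) * z + pi / 2 - real (Suc N) * s (Suc N) =
        real (Suc N) * (z - s (Suc N)) + pi / 2"
      by (simp only: right_diff_distrib)
    then show ?thesis
      by (simp only:) (simp add: sin_add)
  qed
  then have "?t (2 * N + 2) = ?u (pi / 2)"
    by (simp add: shifted_circle_basis_def Let_def)
  moreover have "amalg (shifted_circle_basis s) (2 * Suc N) x y =
      amalg (shifted_circle_basis s) (2 * N) x y + ?t (2 * N + 1) + ?t (2 * N + 2)"
    by (simp add: amalg_def)
  moreover have "phase_sum s b (Suc N) x y = phase_sum s b N x y + ?u b" for b
    by (simp add: phase_sum_def)
  ultimately show ?case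
    using Suc.IH by simp
qed

lemma abs_shifted_circle_basis_le: "\<bar>shifted_circle_basis s k x\<bar> \<le> 1"
  by (simp add: shifted_circle_basis_def Let_def)

lemma abs_amalg_term_le:
  "\<bar>sgn (shifted_circle_basis s k x) * shifted_circle_basis s k y\<bar> \<le> 1"
  using abs_shifted_circle_basis_le[of s k y] by (simp add: abs_mult abs_sgn_eq)

lemma abs_amalg_shifted_le: "\<bar>amalg (shifted_circle_basis s) n x y\<bar> \<le> real n"
proof -
  have "\<bar>amalg (shifted_circle_basis s) n x y\<bar> \<le> (\<Sum>k=1..n. 1)"
    unfolding amalg_def by (intro order_trans[OF sum_abs] sum_mono abs_amalg_term_le)
  then show ?thesis by simp
qed

text \<open>An odd \<open>n\<close> leaves one unpaired sine term, of absolute value at most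
  1.\<close>

lemma abs_amalg_shifted_halve:
  "\<bar>amalg (shifted_circle_basis s) n x y\<bar> \<le>
    1 + \<bar>phase_sum s 0 (n div 2) x y\<bar> + \<bar>phase_sum s (pi / 2) (n div 2) x y\<bar>"
proof (cases "even n")
  case True
  then have "amalg (shifted_circle_basis s) n x y =
      phase_sum s 0 (n div 2) x y + phase_sum s (pi / 2) (n div 2) x y"
    using amalg_shifted_even[of s "n div 2" x y] by simp
  then show ?thesis by linarith
next
  case False
  then obtain N where n: "n = Suc (2 * N)"
    by (metis oddE Suc_eq_plus1)
  then have half: "n div 2 = N" by simp
  have "amalg (shifted_circle_basis s) n x y = amalg (shifted_circle_basis s) (2 * N) x y +
      sgn (shifted_circle_basis s n x) * shifted_circle_basis s n y"
    unfolding n by (simp add: amalg_def)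
  then show ?thesis
    unfolding half using amalg_shifted_even[of s N x y] abs_amalg_term_le[of s n x y] by linarith
qed

text \<open>This part is deterministic. It turns the eventual bounds into one for all
  \<open>n \<ge> 2\<close> with exponent \<open>c = 1 / 2\<close>, letting only the constant depend
  on the points.\<close>

lemma no_spooky_shifted:
  assumes bound: "\<And>b. b \<in> {0, pi / 2} \<Longrightarrow>
    \<forall>\<^sub>F N in sequentially. \<forall>x\<in>circle. \<forall>y\<in>circle. x \<noteq> y \<longrightarrow>
      \<bar>phase_sum s b N x y\<bar> \<le> 7 + 12 * sqrt (real N * ln (real N)) + 1 / \<bar>sin ((y - x) / 2)\<bar>"
  shows "no_spooky_action circle (shifted_circle_basis s)"
proof -
  have "\<forall>\<^sub>F N in sequentially. \<forall>b\<in>{0, pi / 2}. \<forall>x\<in>circle. \<forall>y\<in>circle. x \<noteq> y \<longrightarrow>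
      \<bar>phase_sum s b N x y\<bar> \<le> 7 + 12 * sqrt (real N * ln (real N)) + 1 / \<bar>sin ((y - x) / 2)\<bar>"
    using bound by (intro eventually_ball_finite) auto
  then obtain N0 where N0: "\<And>N b x y. N \<ge> N0 \<Longrightarrow> b \<in> {0, pi / 2} \<Longrightarrow> x \<in> circle \<Longrightarrow>
      y \<in> circle \<Longrightarrow> x \<noteq> y \<Longrightarrow>
      \<bar>phase_sum s b N x y\<bar> \<le> 7 + 12 * sqrt (real N * ln (real N)) + 1 / \<bar>sin ((y - x) / 2)\<bar>"
    unfolding eventually_sequentially by blast
  \<comment> \<open>Here 39 is 15 + 24, where \<open>15 = 1 + 7 + 7\<close> and
    \<open>24 = 12 + 12\<close> come from the unpaired term and the two phase sums. The summand
    \<open>2 * real N0\<close> pays for the small \<open>n\<close> through the trivial bound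
    \<open>n\<close>.\<close>
  have "\<bar>amalg (shifted_circle_basis s) n x y\<bar> \<le>
      (39 + 2 / \<bar>sin ((y - x) / 2)\<bar> + 2 * real N0) * ln (real n) powr (1 / 2) * sqrt (real n)"
    if xy: "x \<in> circle" "y \<in> circle" "x \<noteq> y" and n: "n \<ge> 2" for x y n
  proof -
    let ?d = "1 / \<bar>sin ((y - x) / 2)\<bar>"
    define Q where "Q = sqrt (real n * ln (real n))"
    \<comment> \<open>For \<open>n \<ge> 2\<close> this gives \<open>n * ln n \<ge> 4 / 3\<close>,
      hence \<open>Q \<ge> 1\<close>, so additive constants can be absorbed into multiples of
      \<open>Q\<close>.\<close>
    have "2 / 3 \<le> ln (real n)"
      using ln2_ge_two_thirds ln_le_cancel_iff[of 2 "real n"] n by linarith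
    then have "1 \<le> real n * ln (real n)"
      using n mult_mono[of 2 "real n" "2/3" "ln (real n)"] by simp
    then have Q: "1 \<le> Q"
      by (simp add: Q_def)
    have "\<bar>amalg (shifted_circle_basis s) n x y\<bar> \<le> (39 + 2 * ?d + 2 * real N0) * Q"
    proof (cases "n div 2 \<ge> N0")
      case True
      have half: "1 \<le> n div 2" "n div 2 \<le> n"
        using n by auto
      have "real (n div 2) * ln (real (n div 2)) \<le> real n * ln (real n)"
        using half by (intro mult_mono) (auto simp del: div_le_dividend)
      then have "sqrt (real (n div 2) * ln (real (n div 2))) \<le> Q"
        unfolding Q_def by (rule real_sqrt_le_mono)
      then have "\<bar>amalg (shifted_circle_basis s) n x y\<bar> \<le> 15 + 24 * Q + 2 * ?d"
        using abs_amalg_shifted_halve[of s n x y] N0[OF True _ xy, of 0] N0[OF True _ xy, of "pi / 2"]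
        by simp
      also have "\<dots> \<le> 15 * Q + 24 * Q + 2 * ?d * Q + 2 * real N0 * Q"
      proof -
        have "0 \<le> 2 * real N0 * Q"
          using Q by simp
        moreover have d: "2 * ?d * 1 \<le> 2 * ?d * Q"
          using Q by (intro mult_left_mono) auto
        ultimately show ?thesis
          using Q d by linarith
      qed
      finally show ?thesis
        by (simp add: algebra_simps)
    next
      case False
      then have "real n \<le> 2 * real N0"
        by linarith
      also have "\<dots> \<le> (39 + 2 * ?d + 2 * real N0) * 1"
        by simp
      also have "\<dots> \<le> (39 + 2 * ?d + 2 * real N0) * Q"
        using Q by (intro mult_left_mono) auto
      finally show ?thesis
        using abs_amalg_shifted_le[of s n x y] by linarith
    qed
    also have "Q = ln (real n) powr (1 / 2) * sqrt (real n)"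
      using n by (simp add: Q_def real_sqrt_mult powr_half_sqrt)
    finally show ?thesis
      by (simp add: mult.assoc)
  qed
  then show ?thesis
    unfolding no_spooky_action_def by blast
qed

text \<open>Only the two offsets 0 and \<open>pi / 2\<close> occur, so the exceptional sets of
  \<open>phase_sum_bound\<close> combine into one null set.\<close>

lemma (in prob_space) AE_no_spooky_random_circle:
  fixes X :: "nat \<Rightarrow> 'a \<Rightarrow> real"
  assumes "indep_vars (\<lambda>_. borel) X {1..}"
    and "\<And>k. k \<ge> 1 \<Longrightarrow> distr M borel (X k) = uniform_measure lborel {0..2 * pi}"
  shows "AE \<omega> in M. no_spooky_action circle (shifted_circle_basis (\<lambda>k. X k \<omega>))"
  by (rule AE_mp[OF AE_finite_allI[of "{0, pi / 2}", OF _ phase_sum_bound[OF assms]]])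
    (auto intro!: no_spooky_shifted)

theorem theorem1:
  shows "(\<forall>\<phi>. interval_eigenbasis dirichlet \<phi> \<longrightarrow> strong_spooky_action {0..1} \<phi>) \<and>
    (\<forall>\<phi>. interval_eigenbasis neumann \<phi> \<longrightarrow> strong_spooky_action {0..1} \<phi>) \<and>
    strong_spooky_action circle canonical_circle_basis \<and>
    (\<forall>(P :: 'w measure) (X :: nat \<Rightarrow> 'w \<Rightarrow> real).
       prob_space P \<longrightarrow>
       prob_space.indep_vars P (\<lambda>_. borel) X {1..} \<longrightarrow>
       (\<forall>k\<ge>1. distr P borel (X k) = uniform_measure lborel {0..2 * pi}) \<longrightarrow>
       (AE \<omega> in P. no_spooky_action circle (shifted_circle_basis (\<lambda>k. X k \<omega>))))"
proof (intro conjI allI impI)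
  fix P :: "'w measure" and X :: "nat \<Rightarrow> 'w \<Rightarrow> real"
  assume "prob_space P" "prob_space.indep_vars P (\<lambda>_. borel) X {1..}"
    "\<forall>k\<ge>1. distr P borel (X k) = uniform_measure lborel {0..2 * pi}"
  then show "AE \<omega> in P. no_spooky_action circle (shifted_circle_basis (\<lambda>k. X k \<omega>))"
    by (intro prob_space.AE_no_spooky_random_circle) auto
qed (simp_all add: strong_spooky_dirichlet strong_spooky_neumann strong_spooky_canonical_circle)

end
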